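(* For each $n\ge1$, let $\boldsymbol{\sigma}_n$ be a uniform random separable permutation of size $n$. Then $\mathrm{LIS}(\boldsymbol{\sigma}_n)/n$ converges to $0$ in probability as $n\to\infty$.
   Context: A permutation $\sigma$ of size $n$ contains a pattern $\pi$ of size $k$ if there are indices $i_1<\dots<i_k$ such that $\sigma(i_\ell)<\sigma(i_m)$ iff $\pi(\ell)<\pi(m)$ for all $\ell,m$; otherwise it avoids $\pi$. A separable permutation is a permutation avoiding both patterns $2413$ and $3142$. $\mathrm{LIS}(\sigma)$ is the maximal length $k$ of an increasing subsequence, i.e. of indices $i_1<\dots<i_k$ with $\sigma(i_1)<\dots<\sigma(i_k)$. *)

theory Defs
  imports "HOL-Probability.Probability" "HOL-Combinatorics.Permutations"
begin

text \<open>
  A permutation of size \<open>n\<close> is a function \<open>\<sigma> :: nat \<Rightarrow> nat\<close> with \<open>\<sigma> permutes {1..n}\<close>;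
  being the identity outside \<open>{1..n}\<close>, it does not determine \<open>n\<close>, which is therefore
  passed explicitly below.
\<close>

definition contains_pattern :: "nat \<Rightarrow> (nat \<Rightarrow> nat) \<Rightarrow> nat \<Rightarrow> (nat \<Rightarrow> nat) \<Rightarrow> bool" where
  "contains_pattern n \<sigma> k \<pi> \<longleftrightarrow>
     (\<exists>i. i \<in> {1..k} \<rightarrow> {1..n} \<and> strict_mono_on {1..k} i \<and>
        (\<forall>l\<in>{1..k}. \<forall>m\<in>{1..k}. \<sigma> (i l) < \<sigma> (i m) \<longleftrightarrow> \<pi> l < \<pi> m))"

definition avoids_pattern :: "nat \<Rightarrow> (nat \<Rightarrow> nat) \<Rightarrow> nat \<Rightarrow> (nat \<Rightarrow> nat) \<Rightarrow> bool" where
  "avoids_pattern n \<sigma> k \<pi> \<longleftrightarrow> \<not> contains_pattern n \<sigma> k \<pi>"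

definition pattern_2413 :: "nat \<Rightarrow> nat" where
  "pattern_2413 = id(1 := 2, 2 := 4, 3 := 1, 4 := 3)"

definition pattern_3142 :: "nat \<Rightarrow> nat" where
  "pattern_3142 = id(1 := 3, 2 := 1, 3 := 4, 4 := 2)"

definition separable_perms :: "nat \<Rightarrow> (nat \<Rightarrow> nat) set" where
  "separable_perms n = {\<sigma>. \<sigma> permutes {1..n} \<and>
     avoids_pattern n \<sigma> 4 pattern_2413 \<and> avoids_pattern n \<sigma> 4 pattern_3142}"

definition LIS :: "nat \<Rightarrow> (nat \<Rightarrow> nat) \<Rightarrow> nat" where
  "LIS n \<sigma> = Max {k. \<exists>i. i \<in> {1..k} \<rightarrow> {1..n} \<and> strict_mono_on {1..k} i \<and>
     strict_mono_on {1..k} (\<sigma> \<circ> i)}"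

text \<open>
  Convergence in probability to a constant; the \<open>n\<close>-th random variable may live on its own
  probability space.
\<close>

definition converges_in_prob_const ::
    "(nat \<Rightarrow> 'a measure) \<Rightarrow> (nat \<Rightarrow> 'a \<Rightarrow> real) \<Rightarrow> real \<Rightarrow> bool" where
  "converges_in_prob_const M X c \<longleftrightarrow>
     (\<forall>n. prob_space (M n) \<and> X n \<in> borel_measurable (M n)) \<and>
     (\<forall>\<epsilon>>0. (\<lambda>n. measure (M n) {\<omega> \<in> space (M n). \<bar>X n \<omega> - c\<bar> > \<epsilon>}) \<longlonglongrightarrow> 0)"

lemma pattern_2413_permutes: "pattern_2413 permutes {1..4}"
proof -
  have "bij_betw pattern_2413 {1,2,3,4} {1,2,3,4}"
    by (auto simp: bij_betw_def inj_on_def pattern_2413_def)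
  moreover have "{1..4::nat} = {1,2,3,4}" by auto
  ultimately show ?thesis
    by (intro bij_imp_permutes) (auto simp: pattern_2413_def)
qed

lemma pattern_3142_permutes: "pattern_3142 permutes {1..4}"
proof -
  have "bij_betw pattern_3142 {1,2,3,4} {1,2,3,4}"
    by (auto simp: bij_betw_def inj_on_def pattern_3142_def)
  moreover have "{1..4::nat} = {1,2,3,4}" by auto
  ultimately show ?thesis
    by (intro bij_imp_permutes) (auto simp: pattern_3142_def)
qed

text \<open>
  The next two lemmas ensure that \<open>pmf_of_set (separable_perms n)\<close> is the uniform distribution.
\<close>

lemma finite_separable_perms: "finite (separable_perms n)"
  by (rule finite_subset[OF _ finite_permutations[of "{1..n}"]])
     (auto simp: separable_perms_def)

lemma separable_perms_nonempty: "separable_perms n \<noteq> {}"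
proof -
  have "avoids_pattern n id 4 \<pi>" if "\<pi> 3 < \<pi> 1 \<or> \<pi> 2 < \<pi> 1" for \<pi>
    unfolding avoids_pattern_def contains_pattern_def
  proof clarify
    fix i :: "nat \<Rightarrow> nat"
    assume mono: "strict_mono_on {1..4} i"
      and iff: "\<forall>l\<in>{1..4}. \<forall>m\<in>{1..4}. id (i l) < id (i m) \<longleftrightarrow> \<pi> l < \<pi> m"
    have "i 1 < i 2" "i 1 < i 3" by (rule strict_mono_onD[OF mono]; simp)+
    moreover have "i 3 < i 1 \<longleftrightarrow> \<pi> 3 < \<pi> 1" "i 2 < i 1 \<longleftrightarrow> \<pi> 2 < \<pi> 1"
      using iff by simp_all
    ultimately show False using that by linarith
  qed
  then have "id \<in> separable_perms n"
    by (simp add: separable_perms_def permutes_id pattern_2413_def pattern_3142_def)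
  then show ?thesis by blast
qed

text \<open>The set under \<open>Max\<close> in \<open>LIS\<close> is finite and nonempty, so the maximum is genuine.\<close>

lemma LIS_set_finite_nonempty:
  fixes n :: nat and \<sigma> :: "nat \<Rightarrow> nat"
  defines "K \<equiv> {k :: nat. \<exists>i. i \<in> {1..k} \<rightarrow> {1..n} \<and> strict_mono_on {1..k} i \<and>
     strict_mono_on {1..k} (\<sigma> \<circ> i)}"
  shows "finite K" "K \<noteq> {}"
proof -
  have "k \<le> n" if "k \<in> K" for k
  proof -
    from that obtain i where i: "i \<in> {1..k} \<rightarrow> {1..n}" "strict_mono_on {1..k} i"
      by (auto simp: K_def)
    have "card {1..k} \<le> card {1..n}"
      using i by (intro card_inj_on_le[of i]) (auto dest: strict_mono_on_imp_inj_on)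
    then show ?thesis by simp
  qed
  then show "finite K" by (meson finite_nat_set_iff_bounded_le)
  have "0 \<in> K" by (auto simp: K_def strict_mono_on_def)
  then show "K \<noteq> {}" by blast
qed

end

theory Submission
  imports Defs "HOL-Real_Asymp.Real_Asymp"
begin

text \<open>
  Every separable permutation of size at least 2 is either a direct or a skew sum, of an
  indecomposable first block and an arbitrary separable permutation. LIS is additive on direct sums
  and a maximum on skew sums, so compared with the size it loses the minimum of the two LIS values
  at every skew sum. With \<open>T\<close> the generating function of separable permutations, \<open>A\<close> that of the
  sums of LIS, and \<open>\<Delta>\<close> that of these losses at the root, the algebraic equation for \<open>T\<close> turns
  this into the exact identity \<open>x T' - A = \<Delta> / sqrt (1 - 6 x + x\<^sup>2)\<close>, whose kernel generates the
  central Delannoy numbers \<open>d\<^sub>n\<close>.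

  Let \<open>\<rho> = 3 - 2 sqrt 2\<close>. As \<open>\<rho>\<^sup>n d\<^sub>n\<close> decreases, the mean of LIS over the size is at most
  \<open>1 - (1/\<kappa>) \<Sum>\<^bsub>k \<le> n\<^esub> \<Delta>\<^sub>k \<rho>\<^sup>k\<close> with \<open>\<kappa> = \<rho> (3 - \<rho>) / 2\<close>, so it suffices that \<open>\<Delta>(\<rho>) = \<kappa>\<close>.
  If \<open>\<Delta>(\<rho>) < \<kappa>\<close>, the identity and \<open>\<Sum>\<^bsub>j \<le> N\<^esub> d\<^sub>j \<rho>\<^sup>j \<ge> sqrt N\<close> make the partial sums of
  \<open>A\<close> at \<open>\<rho>\<close> at least of order \<open>sqrt N\<close>. On the other hand, if \<open>F\<^sub>s\<close> is the weight at \<open>\<rho>\<close> of the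
  permutations with LIS exceeding \<open>s\<close>, then \<open>\<Delta>(\<rho>) < \<infinity>\<close> forces \<open>\<Sum> F\<^sub>s\<^sup>2 < \<infinity>\<close>, and by
  Cauchy-Schwarz these partial sums, which are at most \<open>\<Sum>\<^bsub>s < N\<^esub> F\<^sub>s\<close>, are \<open>o(sqrt N)\<close>.
\<close>

section \<open>Existence of a splitting position\<close>

text \<open>The codomain is any linear order so that a skew split can be written as a split of the
  negated values; \<open>free_3142\<close> and \<open>free_2413\<close> are polymorphic for the same
  reason.\<close>

definition split_at :: "nat \<Rightarrow> (nat \<Rightarrow> 'a::linorder) \<Rightarrow> nat \<Rightarrow> bool" where
  "split_at n f i \<longleftrightarrow> 1 \<le> i \<and> i < n \<and> (\<forall>x y. 1 \<le> x \<and> x \<le> i \<and> i < y \<and> y \<le> n \<longrightarrow> f x < f y)"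

definition free_3142 :: "nat \<Rightarrow> (nat \<Rightarrow> 'a::linorder) \<Rightarrow> bool" where
  "free_3142 n f \<longleftrightarrow> (\<forall>p q r s. 1 \<le> p \<and> p < q \<and> q < r \<and> r < s \<and> s \<le> n \<longrightarrow>
     \<not> (f q < f s \<and> f s < f p \<and> f p < f r))"

definition free_2413 :: "nat \<Rightarrow> (nat \<Rightarrow> 'a::linorder) \<Rightarrow> bool" where
  "free_2413 n f \<longleftrightarrow> (\<forall>p q r s. 1 \<le> p \<and> p < q \<and> q < r \<and> r < s \<and> s \<le> n \<longrightarrow>
     \<not> (f r < f p \<and> f p < f s \<and> f s < f q))"

text \<open>Inductive step of \<open>split_exists\<close>. The second alternative is the one in
  which every split can be destroyed by the new last entry, and then cutting off that entry is a
  skew split.\<close>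

lemma split_extend:
  fixes f :: "nat \<Rightarrow> 'a::linorder"
  assumes "split_at n f i" "inj_on f {1..Suc n}" "free_3142 (Suc n) f"
  shows "(\<exists>j. split_at (Suc n) f j) \<or> (\<forall>x. 1 \<le> x \<and> x \<le> n \<longrightarrow> f (Suc n) < f x)"
proof (rule ccontr)
  assume neg: "\<not> ?thesis"
  define v where "v = f (Suc n)"
  (* In the least split m, no element above v may precede one below v: together with n and Suc n they
     would form 3142. Hence the elements below v form a prefix, which would be a smaller split. *)
  define m where "m = (LEAST i. split_at n f i)"
  have m: "split_at n f m"
    unfolding m_def using assms(1) by (rule LeastI)
  have m_least: "m \<le> j" if "split_at n f j" for j
    unfolding m_def using that by (rule Least_le)
  have m1: "1 \<le> m" "m < n" and ms: "\<And>x y. 1 \<le> x \<Longrightarrow> x \<le> m \<Longrightarrow> m < y \<Longrightarrow> y \<le> n \<Longrightarrow> f x < f y"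
    using m unfolding split_at_def by auto
  have ne: "f x \<noteq> v" if "1 \<le> x" "x \<le> n" for x
    using inj_onD[OF assms(2), of x "Suc n"] that by (auto simp: v_def)
  have "\<not> split_at (Suc n) f m" using neg by blast
  then obtain x y where xy: "1 \<le> x" "x \<le> m" "m < y" "y \<le> Suc n" "\<not> f x < f y"
    using m1 unfolding split_at_def by auto
  have "y = Suc n" using ms[of x y] xy by (metis le_SucE)
  then have x: "1 \<le> x" "x \<le> m" "v < f x" using xy ne[of x] m1 by (auto simp: v_def)
  obtain y where y: "1 \<le> y" "y \<le> n" "f y < v"
    using neg ne by (fastforce simp: v_def)
  have ym: "y \<le> m"
    using ms[of x y] x y by (meson leI less_asym less_trans)
  have nopq: False if "1 \<le> p" "p < q" "q \<le> m" "v < f p" "f q < v" for p q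
  proof -
    have "f p < f n" using ms[of p n] that m1 by auto
    moreover have "1 \<le> p \<and> p < q \<and> q < n \<and> n < Suc n \<and> Suc n \<le> Suc n"
      using that m1 by auto
    ultimately show False
      using assms(3) that unfolding free_3142_def v_def by blast
  qed
  define l where "l = Max {y. 1 \<le> y \<and> y \<le> m \<and> f y < v}"
  have fin: "finite {y. 1 \<le> y \<and> y \<le> m \<and> f y < v}" by simp
  have l: "1 \<le> l" "l \<le> m" "f l < v"
  proof -
    have "l \<in> {y. 1 \<le> y \<and> y \<le> m \<and> f y < v}"
      unfolding l_def by (rule Max_in[OF fin]) (use y ym in blast)
    then show "1 \<le> l" "l \<le> m" "f l < v" by auto
  qed
  have lmax: "z \<le> l" if "1 \<le> z" "z \<le> m" "f z < v" for z
    unfolding l_def using fin that by (intro Max_ge) auto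
  have low: "f p < v" if "1 \<le> p" "p \<le> l" for p
  proof (rule ccontr)
    assume "\<not> f p < v"
    then have "v < f p" using ne[of p] that l m1 by auto
    moreover have "p \<noteq> l" using \<open>\<not> f p < v\<close> l by auto
    ultimately show False using nopq[of p l] that l by auto
  qed
  have high: "v < f q" if "l < q" "q \<le> m" for q
    using lmax[of q] that l ne[of q] m1 by (meson leD le_trans less_imp_le_nat linorder_neqE)
  have "x \<noteq> l" using l x by auto
  moreover have "\<not> x < l" using low[of x] x by auto
  ultimately have "l < m" using x by linarith
  moreover have "split_at n f l"
    unfolding split_at_def
  proof (intro conjI allI impI)
    show "1 \<le> l" "l < n" using l m1 by auto
    fix a b assume ab: "1 \<le> a \<and> a \<le> l \<and> l < b \<and> b \<le> n"
    show "f a < f b"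
    proof (cases "b \<le> m")
      case True then show ?thesis using low[of a] high[of b] ab by auto
    next
      case False then show ?thesis using ms[of a b] ab l by auto
    qed
  qed
  ultimately show False using m_least[of l] by auto
qed

text \<open>Induction on \<open>n\<close>, removing the last entry. Negation turns 3142 into 2413,
  so freeness of \<open>f\<close> and of its negation covers both patterns, and
  \<open>split_extend\<close> applies to whichever of the two is split by the induction hypothesis.
  Integer values make the negation available.\<close>

lemma split_exists:
  fixes f :: "nat \<Rightarrow> int"
  assumes "2 \<le> n" "inj_on f {1..n}" "free_3142 n f" "free_3142 n (\<lambda>x. - f x)"
  shows "\<exists>i. split_at n f i \<or> split_at n (\<lambda>x. - f x) i"
  using assms
proof (induction n rule: dec_induct)
  case base
  have "f 1 \<noteq> f 2" using inj_onD[OF base(1), of 1 2] by auto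
  then have "split_at 2 f 1 \<or> split_at 2 (\<lambda>x. - f x) 1"
  proof -
    have "1 \<le> x \<and> x \<le> 1 \<and> 1 < y \<and> y \<le> 2 \<longleftrightarrow> x = 1 \<and> y = 2" for x y :: nat
      by linarith
    then show ?thesis using \<open>f 1 \<noteq> f 2\<close> unfolding split_at_def by auto
  qed
  then show ?case by blast
next
  case (step n)
  have inj: "inj_on f {1..n}" "inj_on (\<lambda>x. - f x) {1..Suc n}"
    using step.prems(1) by (auto simp: inj_on_def)
  have "free_3142 n f" "free_3142 n (\<lambda>x. - f x)"
    using step.prems(2,3) unfolding free_3142_def by (meson le_SucI)+
  then obtain i where i: "split_at n f i \<or> split_at n (\<lambda>x. - f x) i"
    using step.IH inj by blast
  have last: "split_at (Suc n) g n" if "\<forall>x. 1 \<le> x \<and> x \<le> n \<longrightarrow> g x < g (Suc n)" for g :: "nat \<Rightarrow> int"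
    using that step.hyps unfolding split_at_def by (auto simp: le_Suc_eq)
  from i show ?case
  proof
    assume "split_at n f i"
    from split_extend[OF this step.prems(1,2)] last[of "\<lambda>x. - f x"] show ?thesis by auto
  next
    assume "split_at n (\<lambda>x. - f x) i"
    from split_extend[OF this inj(2) step.prems(3)] last[of f] show ?thesis by auto
  qed
qed

section \<open>Patterns of length four as inequalities between four entries\<close>

lemma contains_pattern_4_iff:
  "contains_pattern n \<sigma> 4 \<pi> \<longleftrightarrow>
     (\<exists>p q r s. 1 \<le> p \<and> p < q \<and> q < r \<and> r < s \<and> s \<le> n \<and>
       (\<forall>l\<in>{1..4}. \<forall>m\<in>{1..4}. \<sigma> ([p, q, r, s] ! (l - 1)) < \<sigma> ([p, q, r, s] ! (m - 1)) \<longleftrightarrow> \<pi> l < \<pi> m))"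
    (is "?L \<longleftrightarrow> ?R")
proof -
  have four: "{1..4::nat} = {1, 2, 3, 4}" by auto
  show ?thesis
  proof
    assume ?L
    then obtain i where i: "i \<in> {1..4} \<rightarrow> {1..n}" "strict_mono_on {1..4} i"
      "\<forall>l\<in>{1..4}. \<forall>m\<in>{1..4}. \<sigma> (i l) < \<sigma> (i m) \<longleftrightarrow> \<pi> l < \<pi> m"
      unfolding contains_pattern_def by blast
    \<comment> \<open>The shift \<open>l - 1\<close> reconciles positions counted from 1 with list
      indices counted from 0.\<close>
    have nth: "[i 1, i 2, i 3, i 4] ! (l - 1) = i l" if "l \<in> {1..4}" for l
      using that unfolding four by auto
    have "i 1 < i 2" "i 2 < i 3" "i 3 < i 4"
      by (rule strict_mono_onD[OF i(2)]; simp)+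
    moreover have "1 \<le> i 1" "i 4 \<le> n" using i(1) by (auto simp: Pi_iff)
    ultimately show ?R using i(3) nth by (intro exI[of _ "i 1"] exI[of _ "i 2"] exI[of _ "i 3"] exI[of _ "i 4"]) simp
  next
    assume ?R
    then obtain p q r s where o: "1 \<le> p" "p < q" "q < r" "r < s" "s \<le> n"
      and c: "\<forall>l\<in>{1..4}. \<forall>m\<in>{1..4}. \<sigma> ([p, q, r, s] ! (l - 1)) < \<sigma> ([p, q, r, s] ! (m - 1)) \<longleftrightarrow> \<pi> l < \<pi> m"
      by blast
    show ?L unfolding contains_pattern_def
    proof (intro exI[of _ "\<lambda>l. [p, q, r, s] ! (l - 1)"] conjI c)
      show "(\<lambda>l. [p, q, r, s] ! (l - 1)) \<in> {1..4} \<rightarrow> {1..n}"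
        unfolding four using o by auto
      show "strict_mono_on {1..4} (\<lambda>l. [p, q, r, s] ! (l - 1))"
        unfolding four strict_mono_on_def using o by auto
    qed
  qed
qed

text \<open>A pattern prescribes every pairwise comparison; the chain of three inequalities in
  \<open>free_2413\<close> already implies all of them by transitivity.\<close>

lemma avoids_2413_iff: "avoids_pattern n \<sigma> 4 pattern_2413 \<longleftrightarrow> free_2413 n \<sigma>"
proof -
  have four: "{1..4::nat} = {1, 2, 3, 4}" by auto
  show ?thesis
    unfolding avoids_pattern_def contains_pattern_4_iff free_2413_def four
    by (simp add: pattern_2413_def) (smt (verit) less_asym less_trans less_irrefl)
qed

lemma avoids_3142_iff: "avoids_pattern n \<sigma> 4 pattern_3142 \<longleftrightarrow> free_3142 n \<sigma>"
proof -
  have four: "{1..4::nat} = {1, 2, 3, 4}" by auto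
  show ?thesis
    unfolding avoids_pattern_def contains_pattern_4_iff free_3142_def four
    by (simp add: pattern_3142_def) (smt (verit) less_asym less_trans less_irrefl)
qed

lemma separable_perms_iff:
  "\<sigma> \<in> separable_perms n \<longleftrightarrow> \<sigma> permutes {1..n} \<and> free_2413 n \<sigma> \<and> free_3142 n \<sigma>"
  by (simp add: separable_perms_def avoids_2413_iff avoids_3142_iff)

section \<open>Longest monotone subsequences of direct sums\<close>

text \<open>An increasing subsequence is determined by its set of positions, since listing the set
  in increasing order recovers the index map. Sets are easier than index maps to cut and glue along
  blocks.\<close>

lemma LIS_eq: "LIS n \<sigma> = Max (card ` {S. S \<subseteq> {1..n} \<and> strict_mono_on S \<sigma>})"
proof -
  have "{k. \<exists>i. i \<in> {1..k} \<rightarrow> {1..n} \<and> strict_mono_on {1..k} i \<and> strict_mono_on {1..k} (\<sigma> \<circ> i)}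
      = card ` {S. S \<subseteq> {1..n} \<and> strict_mono_on S \<sigma>}" (is "?K = ?C")
  proof (intro equalityI subsetI)
    fix k assume "k \<in> ?K"
    then obtain i where i: "i \<in> {1..k} \<rightarrow> {1..n}" "strict_mono_on {1..k} i"
      "strict_mono_on {1..k} (\<sigma> \<circ> i)" by auto
    have "strict_mono_on (i ` {1..k}) \<sigma>"
    proof (rule strict_mono_onI)
      fix x y assume "x \<in> i ` {1..k}" "y \<in> i ` {1..k}" "x < y"
      then obtain a b where ab: "a \<in> {1..k}" "b \<in> {1..k}" "x = i a" "y = i b" by blast
      then have "a < b" using i(2) \<open>x < y\<close> by (simp add: strict_mono_on_less)
      then show "\<sigma> x < \<sigma> y" using strict_mono_onD[OF i(3) ab(1,2)] ab by simp
    qed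
    moreover have "card (i ` {1..k}) = k"
      using strict_mono_on_imp_inj_on[OF i(2)] by (simp add: card_image)
    ultimately show "k \<in> ?C" using i(1) by (intro image_eqI[of _ _ "i ` {1..k}"]) auto
  next
    fix k assume "k \<in> ?C"
    then obtain S where S: "S \<subseteq> {1..n}" "strict_mono_on S \<sigma>" "k = card S" by auto
    have fin: "finite S" using S(1) finite_subset by blast
    define xs where "xs = sorted_list_of_set S"
    have xs: "sorted_wrt (<) xs" "set xs = S" "length xs = k"
      using fin S by (simp_all add: xs_def)
    define i where "i = (\<lambda>l. xs ! (l - 1))"
    have inS: "i l \<in> S" if "l \<in> {1..k}" for l
      using that xs by (auto simp: i_def)
    have mono: "i l < i m" if "l \<in> {1..k}" "m \<in> {1..k}" "l < m" for l m
      using sorted_wrt_nth_less[OF xs(1), of "l - 1" "m - 1"] that xs(3)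
      unfolding i_def by auto
    show "k \<in> ?K"
    proof (intro CollectI exI[of _ i] conjI)
      show "i \<in> {1..k} \<rightarrow> {1..n}" using inS S(1) by blast
      show "strict_mono_on {1..k} i" using mono by (rule strict_mono_onI)
      show "strict_mono_on {1..k} (\<sigma> \<circ> i)"
        using mono inS strict_mono_onD[OF S(2)] by (intro strict_mono_onI) auto
    qed
  qed
  then show ?thesis by (simp add: LIS_def)
qed

definition LDS :: "nat \<Rightarrow> (nat \<Rightarrow> nat) \<Rightarrow> nat" where
  "LDS n \<sigma> = Max (card ` {S. S \<subseteq> {1..n} \<and> strict_antimono_on S \<sigma>})"

lemma LIS_ge: "S \<subseteq> {1..n} \<Longrightarrow> strict_mono_on S \<sigma> \<Longrightarrow> card S \<le> LIS n \<sigma>"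
  unfolding LIS_eq by (intro Max_ge) (auto intro: finite_subset[of _ "Pow {1..n}"])

lemma LDS_ge: "S \<subseteq> {1..n} \<Longrightarrow> strict_antimono_on S \<sigma> \<Longrightarrow> card S \<le> LDS n \<sigma>"
  unfolding LDS_def by (intro Max_ge) (auto intro: finite_subset[of _ "Pow {1..n}"])

lemma LIS_witness:
  obtains S where "S \<subseteq> {1..n}" "strict_mono_on S \<sigma>" "card S = LIS n \<sigma>"
proof -
  have "LIS n \<sigma> \<in> card ` {S. S \<subseteq> {1..n} \<and> strict_mono_on S \<sigma>}"
    unfolding LIS_eq by (rule Max_in) (auto intro: finite_subset[of _ "Pow {1..n}"] exI[of _ "{}"])
  then show ?thesis using that by auto
qed

lemma LDS_witness:
  obtains S where "S \<subseteq> {1..n}" "strict_antimono_on S \<sigma>" "card S = LDS n \<sigma>"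
proof -
  have "LDS n \<sigma> \<in> card ` {S. S \<subseteq> {1..n} \<and> strict_antimono_on S \<sigma>}"
    unfolding LDS_def by (rule Max_in) (auto intro: finite_subset[of _ "Pow {1..n}"] exI[of _ "{}"])
  then show ?thesis using that by auto
qed

lemma LIS_le: "LIS n \<sigma> \<le> n"
proof -
  obtain S where S: "S \<subseteq> {1..n}" "strict_mono_on S \<sigma>" "card S = LIS n \<sigma>" by (rule LIS_witness)
  then show ?thesis using card_mono[OF _ S(1)] by simp
qed

lemma LDS_le: "LDS n \<sigma> \<le> n"
proof -
  obtain S where S: "S \<subseteq> {1..n}" "strict_antimono_on S \<sigma>" "card S = LDS n \<sigma>" by (rule LDS_witness)
  then show ?thesis using card_mono[OF _ S(1)] by simp
qed

lemma LIS_1: "LIS 1 \<sigma> = 1"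
proof -
  have "strict_mono_on {1} \<sigma>" by (simp add: monotone_on_def)
  then have "1 \<le> LIS 1 \<sigma>" using LIS_ge[of "{1}" 1 \<sigma>] by simp
  then show ?thesis using LIS_le[of 1 \<sigma>] by simp
qed

lemma LDS_1: "LDS 1 \<sigma> = 1"
proof -
  have "strict_antimono_on {1} \<sigma>" by (simp add: monotone_on_def)
  then have "1 \<le> LDS 1 \<sigma>" using LDS_ge[of "{1}" 1 \<sigma>] by simp
  then show ?thesis using LDS_le[of 1 \<sigma>] by simp
qed

section \<open>Complementation of values, exchanging LIS with LDS and 2413 with 3142\<close>

definition flip :: "nat \<Rightarrow> nat \<Rightarrow> nat" where
  "flip n x = (if x \<in> {1..n} then Suc n - x else x)"

lemma flip_flip: "flip n (flip n x) = x"
  by (auto simp: flip_def)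

text \<open>As \<open>flip n\<close> is the identity outside \<open>{1..n}\<close>, composing with
  it stays within the permutations of \<open>{1..n}\<close>.\<close>

lemma flip_permutes: "flip n permutes {1..n}"
proof (rule bij_imp_permutes)
  show "bij_betw (flip n) {1..n} {1..n}"
    by (rule bij_betw_byWitness[of _ "flip n"]) (auto simp: flip_flip flip_def)
qed (auto simp: flip_def)

lemma flip_less_iff:
  "x \<in> {1..n} \<Longrightarrow> y \<in> {1..n} \<Longrightarrow> flip n x < flip n y \<longleftrightarrow> y < x"
  by (auto simp: flip_def)

context
  fixes n :: nat and \<sigma> :: "nat \<Rightarrow> nat"
  assumes perm: "\<sigma> permutes {1..n}"
begin

lemma flip_comp_less_iff:
  "1 \<le> x \<Longrightarrow> x \<le> n \<Longrightarrow> 1 \<le> y \<Longrightarrow> y \<le> n \<Longrightarrow> (flip n \<circ> \<sigma>) x < (flip n \<circ> \<sigma>) y \<longleftrightarrow> \<sigma> y < \<sigma> x"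
  using permutes_in_image[OF perm, of x] permutes_in_image[OF perm, of y]
  by (simp add: flip_less_iff)

lemma LIS_flip: "LIS n (flip n \<circ> \<sigma>) = LDS n \<sigma>"
proof -
  have "strict_mono_on S (flip n \<circ> \<sigma>) \<longleftrightarrow> strict_antimono_on S \<sigma>" if "S \<subseteq> {1..n}" for S
    using that flip_comp_less_iff unfolding monotone_on_def by (auto simp: subset_iff)
  then show ?thesis unfolding LIS_eq LDS_def by (metis (no_types, lifting))
qed

lemma free_2413_flip: "free_2413 n (flip n \<circ> \<sigma>) \<longleftrightarrow> free_3142 n \<sigma>"
proof -
  have "(flip n \<circ> \<sigma>) r < (flip n \<circ> \<sigma>) p \<and> (flip n \<circ> \<sigma>) p < (flip n \<circ> \<sigma>) s \<and> (flip n \<circ> \<sigma>) s < (flip n \<circ> \<sigma>) q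
      \<longleftrightarrow> \<sigma> q < \<sigma> s \<and> \<sigma> s < \<sigma> p \<and> \<sigma> p < \<sigma> r"
    if "1 \<le> p \<and> p < q \<and> q < r \<and> r < s \<and> s \<le> n" for p q r s
    using that flip_comp_less_iff[of r p] flip_comp_less_iff[of p s] flip_comp_less_iff[of s q] by auto
  then show ?thesis unfolding free_2413_def free_3142_def by blast
qed

text \<open>Links the two descriptions of a skew split: complemented natural numbers, and negated
  integers as in \<open>split_exists\<close>.\<close>

lemma split_at_flip: "split_at n (flip n \<circ> \<sigma>) i \<longleftrightarrow> split_at n (\<lambda>x. - int (\<sigma> x)) i"
  unfolding split_at_def using flip_comp_less_iff by auto

end

lemma flip_comp_flip: "flip n \<circ> (flip n \<circ> \<sigma>) = \<sigma>"
  by (simp add: fun_eq_iff flip_flip)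

lemma flip_comp_permutes: "\<sigma> permutes {1..n} \<Longrightarrow> flip n \<circ> \<sigma> permutes {1..n}"
  by (rule permutes_compose[OF _ flip_permutes])

lemma flip_separable:
  assumes "\<sigma> \<in> separable_perms n"
  shows "flip n \<circ> \<sigma> \<in> separable_perms n"
proof -
  have \<sigma>: "\<sigma> permutes {1..n}" "free_2413 n \<sigma>" "free_3142 n \<sigma>"
    using assms by (simp_all only: separable_perms_iff)
  show ?thesis
    using free_2413_flip[OF \<sigma>(1)] free_2413_flip[OF flip_comp_permutes[OF \<sigma>(1)]] \<sigma>
    by (simp only: separable_perms_iff flip_comp_permutes flip_comp_flip simp_thms)
qed

lemma LDS_flip: "\<sigma> permutes {1..n} \<Longrightarrow> LDS n (flip n \<circ> \<sigma>) = LIS n \<sigma>"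
  using LIS_flip[OF flip_comp_permutes] by (simp add: flip_comp_flip)

section \<open>Direct sums of permutations\<close>

definition direct_sum :: "nat \<Rightarrow> (nat \<Rightarrow> nat) \<Rightarrow> (nat \<Rightarrow> nat) \<Rightarrow> nat \<Rightarrow> nat" where
  "direct_sum i \<sigma> \<tau> x = (if x \<le> i then \<sigma> x else i + \<tau> (x - i))"

context
  fixes i m :: nat and \<sigma> \<tau> :: "nat \<Rightarrow> nat"
  assumes perm1: "\<sigma> permutes {1..i}" and perm2: "\<tau> permutes {1..m}"
begin

lemma direct_sum_low: "1 \<le> x \<Longrightarrow> x \<le> i \<Longrightarrow> direct_sum i \<sigma> \<tau> x \<in> {1..i}"
  using permutes_in_image[OF perm1, of x] by (simp add: direct_sum_def)

lemma direct_sum_high: "i < x \<Longrightarrow> x \<le> i + m \<Longrightarrow> direct_sum i \<sigma> \<tau> x \<in> {i<..i + m}"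
  using permutes_in_image[OF perm2, of "x - i"] by (auto simp: direct_sum_def)

lemma direct_sum_less: "1 \<le> x \<Longrightarrow> x \<le> i \<Longrightarrow> i < y \<Longrightarrow> y \<le> i + m \<Longrightarrow> direct_sum i \<sigma> \<tau> x < direct_sum i \<sigma> \<tau> y"
  using direct_sum_low[of x] direct_sum_high[of y] by auto

text \<open>The size \<open>m\<close> of the second block is not an argument of
  \<open>direct_sum\<close>: beyond it \<open>\<tau>\<close> is the identity, which makes the sum
  the identity beyond \<open>i + m\<close>.\<close>

lemma direct_sum_permutes: "direct_sum i \<sigma> \<tau> permutes {1..i + m}"
proof (rule inj_imp_permutes)
  show "inj_on (direct_sum i \<sigma> \<tau>) {1..i + m}"
  proof (rule linorder_inj_onI')
    fix x y assume xy: "x \<in> {1..i + m}" "y \<in> {1..i + m}" "x < y"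
    consider "y \<le> i" | "x \<le> i" "i < y" | "i < x" using xy(3) by linarith
    then show "direct_sum i \<sigma> \<tau> x \<noteq> direct_sum i \<sigma> \<tau> y"
    proof cases
      case 1 then show ?thesis
        using xy by (simp add: direct_sum_def inj_eq[OF permutes_inj[OF perm1]])
    next
      case 2 then show ?thesis using direct_sum_less[of x y] xy by auto
    next
      case 3 then show ?thesis
        using xy by (simp add: direct_sum_def inj_eq[OF permutes_inj[OF perm2]] eq_diff_iff)
    qed
  qed
  show "direct_sum i \<sigma> \<tau> x \<in> {1..i + m}" if "x \<in> {1..i + m}" for x
    using direct_sum_low[of x] direct_sum_high[of x] that by (cases "x \<le> i") auto
  show "direct_sum i \<sigma> \<tau> x = x" if "x \<notin> {1..i + m}" for x
    using that permutes_not_in[OF perm1, of x] permutes_not_in[OF perm2, of "x - i"]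
    by (cases "x = 0") (auto simp: direct_sum_def not_le)
qed simp

lemma split_at_direct_sum: "1 \<le> i \<Longrightarrow> 1 \<le> m \<Longrightarrow> split_at (i + m) (direct_sum i \<sigma> \<tau>) i"
  unfolding split_at_def using direct_sum_less by auto

text \<open>A split strictly before the boundary concerns the first block only, the second lying
  above it anyway. Thus the first block is indecomposable exactly when the boundary is the least
  split.\<close>

lemma split_at_direct_sum_less:
  assumes "j < i"
  shows "split_at (i + m) (direct_sum i \<sigma> \<tau>) j \<longleftrightarrow> split_at i \<sigma> j"
proof
  assume *: "split_at (i + m) (direct_sum i \<sigma> \<tau>) j"
  have "\<sigma> x < \<sigma> y" if "1 \<le> x \<and> x \<le> j \<and> j < y \<and> y \<le> i" for x y
    using * that unfolding split_at_def by (force simp: direct_sum_def)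
  then show "split_at i \<sigma> j" using * assms unfolding split_at_def by auto
next
  assume *: "split_at i \<sigma> j"
  have "direct_sum i \<sigma> \<tau> x < direct_sum i \<sigma> \<tau> y" if "1 \<le> x \<and> x \<le> j \<and> j < y \<and> y \<le> i + m" for x y
  proof (cases "y \<le> i")
    case True then show ?thesis using * that unfolding split_at_def by (auto simp: direct_sum_def)
  next
    case False then show ?thesis using direct_sum_less[of x y] that assms by auto
  qed
  then show "split_at (i + m) (direct_sum i \<sigma> \<tau>) j" using * unfolding split_at_def by auto
qed

text \<open>The pattern 2413 is not a direct sum, so no occurrence straddles the boundary: if
  \<open>p\<close> is in the first block, so is \<open>r\<close>, which carries a smaller value,
  hence also \<open>q\<close> before it, and then \<open>s\<close>, whose value is below that of
  \<open>q\<close>.\<close>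

lemma free_2413_direct_sum: "free_2413 (i + m) (direct_sum i \<sigma> \<tau>) \<longleftrightarrow> free_2413 i \<sigma> \<and> free_2413 m \<tau>"
proof (intro iffI conjI)
  assume *: "free_2413 (i + m) (direct_sum i \<sigma> \<tau>)"
  show "free_2413 i \<sigma>"
    unfolding free_2413_def
  proof (intro allI impI)
    fix p q r s assume "1 \<le> p \<and> p < q \<and> q < r \<and> r < s \<and> s \<le> i"
    then show "\<not> (\<sigma> r < \<sigma> p \<and> \<sigma> p < \<sigma> s \<and> \<sigma> s < \<sigma> q)"
      using *[unfolded free_2413_def, rule_format, of p q r s] by (simp add: direct_sum_def)
  qed
  show "free_2413 m \<tau>"
    unfolding free_2413_def
  proof (intro allI impI)
    fix p q r s assume "1 \<le> p \<and> p < q \<and> q < r \<and> r < s \<and> s \<le> m"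
    then show "\<not> (\<tau> r < \<tau> p \<and> \<tau> p < \<tau> s \<and> \<tau> s < \<tau> q)"
      using *[unfolded free_2413_def, rule_format, of "i + p" "i + q" "i + r" "i + s"]
      by (simp add: direct_sum_def)
  qed
next
  assume *: "free_2413 i \<sigma> \<and> free_2413 m \<tau>"
  show "free_2413 (i + m) (direct_sum i \<sigma> \<tau>)"
    unfolding free_2413_def
  proof (intro allI impI notI)
    let ?f = "direct_sum i \<sigma> \<tau>"
    fix p q r s assume o: "1 \<le> p \<and> p < q \<and> q < r \<and> r < s \<and> s \<le> i + m"
      and f: "?f r < ?f p \<and> ?f p < ?f s \<and> ?f s < ?f q"
    show False
    proof (cases "p \<le> i")
      case True
      then have "r \<le> i" using direct_sum_less[of p r] o f by force
      then have "s \<le> i" using direct_sum_less[of q s] o f by force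
      then show False using * o f by (auto simp: free_2413_def direct_sum_def)
    next
      case False
      then show False
        using conjunct2[OF *, unfolded free_2413_def, rule_format, of "p - i" "q - i" "r - i" "s - i"] o f
        by (simp add: direct_sum_def) linarith
    qed
  qed
qed

text \<open>As for 2413; here the last position \<open>s\<close> carries a smaller value than
  \<open>p\<close>, so \<open>p\<close> in the first block forces all four into it.\<close>

lemma free_3142_direct_sum: "free_3142 (i + m) (direct_sum i \<sigma> \<tau>) \<longleftrightarrow> free_3142 i \<sigma> \<and> free_3142 m \<tau>"
proof (intro iffI conjI)
  assume *: "free_3142 (i + m) (direct_sum i \<sigma> \<tau>)"
  show "free_3142 i \<sigma>"
    unfolding free_3142_def
  proof (intro allI impI)
    fix p q r s assume "1 \<le> p \<and> p < q \<and> q < r \<and> r < s \<and> s \<le> i"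
    then show "\<not> (\<sigma> q < \<sigma> s \<and> \<sigma> s < \<sigma> p \<and> \<sigma> p < \<sigma> r)"
      using *[unfolded free_3142_def, rule_format, of p q r s] by (simp add: direct_sum_def)
  qed
  show "free_3142 m \<tau>"
    unfolding free_3142_def
  proof (intro allI impI)
    fix p q r s assume "1 \<le> p \<and> p < q \<and> q < r \<and> r < s \<and> s \<le> m"
    then show "\<not> (\<tau> q < \<tau> s \<and> \<tau> s < \<tau> p \<and> \<tau> p < \<tau> r)"
      using *[unfolded free_3142_def, rule_format, of "i + p" "i + q" "i + r" "i + s"]
      by (simp add: direct_sum_def)
  qed
next
  assume *: "free_3142 i \<sigma> \<and> free_3142 m \<tau>"
  show "free_3142 (i + m) (direct_sum i \<sigma> \<tau>)"
    unfolding free_3142_def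
  proof (intro allI impI notI)
    let ?f = "direct_sum i \<sigma> \<tau>"
    fix p q r s assume o: "1 \<le> p \<and> p < q \<and> q < r \<and> r < s \<and> s \<le> i + m"
      and f: "?f q < ?f s \<and> ?f s < ?f p \<and> ?f p < ?f r"
    show False
    proof (cases "p \<le> i")
      case True
      then have "s \<le> i" using direct_sum_less[of p s] o f by force
      then show False using * o f by (auto simp: free_3142_def direct_sum_def)
    next
      case False
      then show False
        using conjunct2[OF *, unfolded free_3142_def, rule_format, of "p - i" "q - i" "r - i" "s - i"] o f
        by (simp add: direct_sum_def) linarith
    qed
  qed
qed

lemma direct_sum_separable_iff:
  "direct_sum i \<sigma> \<tau> \<in> separable_perms (i + m) \<longleftrightarrow> \<sigma> \<in> separable_perms i \<and> \<tau> \<in> separable_perms m"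
  unfolding separable_perms_iff free_2413_direct_sum free_3142_direct_sum
  using perm1 perm2 direct_sum_permutes by blast

text \<open>An increasing set restricts to each block, and increasing sets of the two blocks can
  always be glued.\<close>

lemma LIS_direct_sum: "LIS (i + m) (direct_sum i \<sigma> \<tau>) = LIS i \<sigma> + LIS m \<tau>"
proof (rule antisym)
  obtain S where S: "S \<subseteq> {1..i + m}" "strict_mono_on S (direct_sum i \<sigma> \<tau>)"
    "card S = LIS (i + m) (direct_sum i \<sigma> \<tau>)" by (rule LIS_witness)
  let ?A = "S \<inter> {1..i}" and ?B = "(\<lambda>x. x - i) ` (S \<inter> {i<..i + m})"
  have "strict_mono_on ?A \<sigma>"
  proof (rule strict_mono_onI)
    fix x y assume "x \<in> ?A" "y \<in> ?A" "x < y"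
    then show "\<sigma> x < \<sigma> y" using strict_mono_onD[OF S(2), of x y] by (simp add: direct_sum_def)
  qed
  then have a: "card ?A \<le> LIS i \<sigma>" by (intro LIS_ge) auto
  have "strict_mono_on ?B \<tau>"
  proof (rule strict_mono_onI)
    fix x y assume "x \<in> ?B" "y \<in> ?B" "x < y"
    then obtain x' y' where "x' \<in> S" "i < x'" "y' \<in> S" "i < y'" "x = x' - i" "y = y' - i" by auto
    then show "\<tau> x < \<tau> y"
      using strict_mono_onD[OF S(2), of x' y'] \<open>x < y\<close> by (simp add: direct_sum_def)
  qed
  then have b: "card ?B \<le> LIS m \<tau>" by (intro LIS_ge) auto
  have "card ?B = card (S \<inter> {i<..i + m})"
    by (rule card_image) (auto simp: inj_on_def)
  moreover have "card S = card ?A + card (S \<inter> {i<..i + m})"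
  proof -
    have "S = ?A \<union> (S \<inter> {i<..i + m})" using S(1) by fastforce
    moreover have "?A \<inter> (S \<inter> {i<..i + m}) = {}" by auto
    moreover have "card (?A \<union> (S \<inter> {i<..i + m})) = card ?A + card (S \<inter> {i<..i + m})"
      by (rule card_Un_disjoint) auto
    ultimately show ?thesis by simp
  qed
  ultimately show "LIS (i + m) (direct_sum i \<sigma> \<tau>) \<le> LIS i \<sigma> + LIS m \<tau>"
    using a b S(3) by linarith
next
  obtain S where S: "S \<subseteq> {1..i}" "strict_mono_on S \<sigma>" "card S = LIS i \<sigma>" by (rule LIS_witness)
  obtain R where R: "R \<subseteq> {1..m}" "strict_mono_on R \<tau>" "card R = LIS m \<tau>" by (rule LIS_witness)
  have "strict_mono_on (S \<union> (\<lambda>x. i + x) ` R) (direct_sum i \<sigma> \<tau>)"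
  proof (rule strict_mono_onI)
    fix x y assume xy: "x \<in> S \<union> (\<lambda>x. i + x) ` R" "y \<in> S \<union> (\<lambda>x. i + x) ` R" "x < y"
    consider "x \<in> S" "y \<in> S" | "x \<in> S" "y \<in> (\<lambda>x. i + x) ` R"
      | "x \<in> (\<lambda>x. i + x) ` R" "y \<in> (\<lambda>x. i + x) ` R"
      using xy S(1) by force
    then show "direct_sum i \<sigma> \<tau> x < direct_sum i \<sigma> \<tau> y"
    proof cases
      case 1 then show ?thesis
        using strict_mono_onD[OF S(2)] xy(3) S(1) by (auto simp: direct_sum_def subset_iff)
    next
      case 2 then show ?thesis
        using S(1) R(1) by (intro direct_sum_less) (auto simp: subset_iff)
    next
      case 3 then show ?thesis
        using strict_mono_onD[OF R(2)] xy(3) R(1) by (auto simp: direct_sum_def subset_iff)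
    qed
  qed
  moreover have "S \<union> (\<lambda>x. i + x) ` R \<subseteq> {1..i + m}" using S(1) R(1) by (force simp: subset_iff)
  ultimately have "card (S \<union> (\<lambda>x. i + x) ` R) \<le> LIS (i + m) (direct_sum i \<sigma> \<tau>)" by (intro LIS_ge)
  moreover have "card (S \<union> (\<lambda>x. i + x) ` R) = card S + card ((\<lambda>x. i + x) ` R)"
  proof (rule card_Un_disjoint)
    show "finite S" "finite ((\<lambda>x. i + x) ` R)"
      using finite_subset[OF S(1)] finite_subset[OF R(1)] by auto
    show "S \<inter> (\<lambda>x. i + x) ` R = {}" using S(1) R(1) by fastforce
  qed
  moreover have "card ((\<lambda>x. i + x) ` R) = card R" by (intro card_image) (auto simp: inj_on_def)
  ultimately show "LIS i \<sigma> + LIS m \<tau> \<le> LIS (i + m) (direct_sum i \<sigma> \<tau>)" using S(3) R(3) by simp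
qed

text \<open>A decreasing set cannot meet both blocks.\<close>

lemma LDS_direct_sum: "LDS (i + m) (direct_sum i \<sigma> \<tau>) = max (LDS i \<sigma>) (LDS m \<tau>)"
proof (rule antisym)
  obtain S where S: "S \<subseteq> {1..i + m}" "strict_antimono_on S (direct_sum i \<sigma> \<tau>)"
    "card S = LDS (i + m) (direct_sum i \<sigma> \<tau>)" by (rule LDS_witness)
  have SD: "direct_sum i \<sigma> \<tau> y < direct_sum i \<sigma> \<tau> x" if "x \<in> S" "y \<in> S" "x < y" for x y
    using monotone_onD[OF S(2)] that by blast
  have "S \<subseteq> {1..i} \<or> S \<subseteq> {i<..i + m}"
  proof (rule ccontr)
    assume "\<not> ?thesis"
    then obtain x y where "x \<in> S" "1 \<le> x" "x \<le> i" "y \<in> S" "i < y" "y \<le> i + m"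
      using S(1) by fastforce
    then show False using SD[of x y] direct_sum_less[of x y] by auto
  qed
  then show "LDS (i + m) (direct_sum i \<sigma> \<tau>) \<le> max (LDS i \<sigma>) (LDS m \<tau>)"
  proof
    assume *: "S \<subseteq> {1..i}"
    have "strict_antimono_on S \<sigma>"
    proof (rule monotone_onI)
      fix x y assume "x \<in> S" "y \<in> S" "x < y"
      then show "\<sigma> y < \<sigma> x" using SD[of x y] * by (auto simp: direct_sum_def subset_iff)
    qed
    then show ?thesis using LDS_ge[OF *] S(3) by fastforce
  next
    assume *: "S \<subseteq> {i<..i + m}"
    let ?B = "(\<lambda>x. x - i) ` S"
    have "strict_antimono_on ?B \<tau>"
    proof (rule monotone_onI)
      fix x y assume "x \<in> ?B" "y \<in> ?B" "x < y"
      then obtain x' y' where "x' \<in> S" "i < x'" "y' \<in> S" "i < y'" "x = x' - i" "y = y' - i"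
        using * by auto
      then show "\<tau> y < \<tau> x" using SD[of x' y'] \<open>x < y\<close> by (simp add: direct_sum_def)
    qed
    moreover have "?B \<subseteq> {1..m}"
    proof
      fix x assume "x \<in> ?B"
      then obtain y where "y \<in> S" "x = y - i" by blast
      moreover from this have "y \<in> {i<..i + m}" using * by blast
      ultimately show "x \<in> {1..m}" by auto
    qed
    ultimately have "card ?B \<le> LDS m \<tau>" by (intro LDS_ge)
    moreover have "card ?B = card S" using * by (intro card_image) (force simp: inj_on_def)
    ultimately show ?thesis using S(3) by simp
  qed
next
  obtain S where S: "S \<subseteq> {1..i}" "strict_antimono_on S \<sigma>" "card S = LDS i \<sigma>" by (rule LDS_witness)
  obtain R where R: "R \<subseteq> {1..m}" "strict_antimono_on R \<tau>" "card R = LDS m \<tau>" by (rule LDS_witness)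
  have "strict_antimono_on S (direct_sum i \<sigma> \<tau>)"
    using monotone_onD[OF S(2)] S(1) by (intro monotone_onI) (auto simp: direct_sum_def subset_iff)
  then have "card S \<le> LDS (i + m) (direct_sum i \<sigma> \<tau>)" using S(1) by (intro LDS_ge) auto
  moreover have "strict_antimono_on ((\<lambda>x. i + x) ` R) (direct_sum i \<sigma> \<tau>)"
    using monotone_onD[OF R(2)] R(1) by (intro monotone_onI) (auto simp: direct_sum_def subset_iff)
  then have "card ((\<lambda>x. i + x) ` R) \<le> LDS (i + m) (direct_sum i \<sigma> \<tau>)" using R(1) by (intro LDS_ge) auto
  moreover have "card ((\<lambda>x. i + x) ` R) = card R" by (intro card_image) (auto simp: inj_on_def)
  ultimately show "max (LDS i \<sigma>) (LDS m \<tau>) \<le> LDS (i + m) (direct_sum i \<sigma> \<tau>)" using S(3) R(3) by simp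
qed

end

lemma split_at_imp_direct_sum:
  assumes perm: "\<sigma> permutes {1..n}" and split: "split_at n \<sigma> i"
  obtains \<sigma>' \<tau>' where "\<sigma>' permutes {1..i}" "\<tau>' permutes {1..n - i}" "\<sigma> = direct_sum i \<sigma>' \<tau>'"
proof -
  have i: "1 \<le> i" "i < n" and s: "\<And>x y. 1 \<le> x \<Longrightarrow> x \<le> i \<Longrightarrow> i < y \<Longrightarrow> y \<le> n \<Longrightarrow> \<sigma> x < \<sigma> y"
    using split unfolding split_at_def by auto
  have inj: "inj_on \<sigma> X" for X using permutes_inj[OF perm] by (rule inj_on_subset) simp
  have ran: "1 \<le> \<sigma> x" "\<sigma> x \<le> n" if "1 \<le> x" "x \<le> n" for x
    using permutes_in_image[OF perm, of x] that by auto
  \<comment> \<open>Counting: the \<open>n - i\<close> values to the right of the split all have to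
    fit above \<open>\<sigma> x\<close>.\<close>
  have low: "\<sigma> x \<le> i" if x: "1 \<le> x" "x \<le> i" for x
  proof -
    have "\<sigma> ` {i<..n} \<subseteq> {\<sigma> x<..n}" using s[OF x] ran i by auto
    then have "card {i<..n} \<le> card {\<sigma> x<..n}"
      using card_mono[of "{\<sigma> x<..n}" "\<sigma> ` {i<..n}"] inj by (simp add: card_image)
    then show ?thesis using ran[of x] x i by simp
  qed
  \<comment> \<open>Dually, the \<open>i\<close> values to the left of the split all have to fit
    below \<open>\<sigma> y\<close>.\<close>
  have high: "i < \<sigma> y" if y: "i < y" "y \<le> n" for y
  proof -
    have "\<sigma> ` {1..i} \<subseteq> {1..<\<sigma> y}" using s y ran i by auto
    then have "card {1..i} \<le> card {1..<\<sigma> y}"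
      using card_mono[of "{1..<\<sigma> y}" "\<sigma> ` {1..i}"] inj by (simp add: card_image)
    then show ?thesis using i by auto
  qed
  define \<sigma>' where "\<sigma>' = (\<lambda>x. if x \<le> i then \<sigma> x else x)"
  define \<tau>' where "\<tau>' = (\<lambda>x. \<sigma> (x + i) - i)"
  show thesis
  proof (rule that)
    show "\<sigma>' permutes {1..i}"
    proof (rule inj_imp_permutes)
      show "inj_on \<sigma>' {1..i}" by (simp add: inj_on_def \<sigma>'_def inj_eq[OF permutes_inj[OF perm]])
      show "\<sigma>' x \<in> {1..i}" if "x \<in> {1..i}" for x using that low[of x] ran[of x] i by (simp add: \<sigma>'_def)
      show "\<sigma>' x = x" if "x \<notin> {1..i}" for x
        using that permutes_not_in[OF perm, of x] by (auto simp: \<sigma>'_def)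
    qed simp
    show "\<tau>' permutes {1..n - i}"
    proof (rule inj_imp_permutes)
      show "inj_on \<tau>' {1..n - i}"
      proof (rule inj_onI)
        fix x y assume "x \<in> {1..n - i}" "y \<in> {1..n - i}" "\<tau>' x = \<tau>' y"
        then have "\<sigma> (x + i) = \<sigma> (y + i)"
          using high[of "x + i"] high[of "y + i"] by (simp add: \<tau>'_def) linarith
        then show "x = y" by (simp add: inj_eq[OF permutes_inj[OF perm]])
      qed
      show "\<tau>' x \<in> {1..n - i}" if "x \<in> {1..n - i}" for x
      proof -
        have "i < \<sigma> (x + i)" "\<sigma> (x + i) \<le> n"
          using that high[of "x + i"] ran[of "x + i"] by auto
        then show ?thesis by (simp add: \<tau>'_def) linarith
      qed
      show "\<tau>' x = x" if "x \<notin> {1..n - i}" for x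
      proof (cases "x = 0")
        case True
        \<comment> \<open>Here \<open>\<tau>' 0\<close> is \<open>\<sigma> i - i\<close>, which
          truncated subtraction makes 0.\<close>
        then show ?thesis using low[of i] i by (simp add: \<tau>'_def)
      next
        case False
        then show ?thesis using that permutes_not_in[OF perm, of "x + i"] by (simp add: \<tau>'_def)
      qed
    qed simp
    show "\<sigma> = direct_sum i \<sigma>' \<tau>'"
    proof
      fix x
      consider "x \<le> i" | "i < x" "x \<le> n" | "n < x" by linarith
      then show "\<sigma> x = direct_sum i \<sigma>' \<tau>' x"
      proof cases
        case 1 then show ?thesis by (simp add: direct_sum_def \<sigma>'_def)
      next
        case 2 then show ?thesis using high[of x] by (simp add: direct_sum_def \<tau>'_def)
      next
        case 3 then show ?thesis using i permutes_not_in[OF perm, of x] by (simp add: direct_sum_def \<tau>'_def)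
      qed
    qed
  qed
qed

section \<open>Unique decomposition and generating functions\<close>

text \<open>Only direct sums count as decomposable: skew sums, and the permutations of sizes 0 and
  1, are among the \<open>indecomposables\<close>.\<close>

definition decomposables :: "nat \<Rightarrow> (nat \<Rightarrow> nat) set" where
  "decomposables n = {\<sigma> \<in> separable_perms n. \<exists>i. split_at n \<sigma> i}"

definition indecomposables :: "nat \<Rightarrow> (nat \<Rightarrow> nat) set" where
  "indecomposables n = separable_perms n - decomposables n"

lemma separable_permutes: "\<sigma> \<in> separable_perms n \<Longrightarrow> \<sigma> permutes {1..n}"
  by (simp only: separable_perms_iff)

lemma indecomposables_permutes: "\<sigma> \<in> indecomposables n \<Longrightarrow> \<sigma> permutes {1..n}"
  unfolding indecomposables_def using separable_permutes by blast

lemma finite_indecomposables: "finite (indecomposables n)"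
  by (simp add: indecomposables_def finite_separable_perms)

lemma decomposables_subset: "decomposables n \<subseteq> separable_perms n"
  by (auto simp: decomposables_def)

lemma sum_separable_eq:
  fixes w :: "(nat \<Rightarrow> nat) \<Rightarrow> 'a::comm_monoid_add"
  shows "sum w (separable_perms n) = sum w (indecomposables n) + sum w (decomposables n)"
  unfolding indecomposables_def
  by (rule sum.subset_diff[OF decomposables_subset finite_separable_perms])

text \<open>If the cuts differed, the smaller one would split the indecomposable first block
  belonging to the larger one. With equal cuts both blocks can be read off.\<close>

lemma direct_sum_inject:
  assumes "direct_sum i \<sigma> \<tau> = direct_sum j \<sigma>' \<tau>'" "1 \<le> i" "i < n" "1 \<le> j" "j < n"
    and "\<sigma> \<in> indecomposables i" "\<tau> permutes {1..n - i}"
    and "\<sigma>' \<in> indecomposables j" "\<tau>' permutes {1..n - j}"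
  shows "i = j \<and> \<sigma> = \<sigma>' \<and> \<tau> = \<tau>'"
proof -
  have no_less: False
    if "i < j" "direct_sum i \<sigma> \<tau> = direct_sum j \<sigma>' \<tau>'" "1 \<le> i" "j < n"
      "\<sigma> permutes {1..i}" "\<tau> permutes {1..n - i}" "\<sigma>' \<in> indecomposables j" "\<tau>' permutes {1..n - j}"
    for i j \<sigma> \<tau> \<sigma>' \<tau>'
  proof -
    have "split_at n (direct_sum j \<sigma>' \<tau>') i"
      using split_at_direct_sum[OF that(5,6,3)] that(1-4) by simp
    then have "split_at j \<sigma>' i"
      using split_at_direct_sum_less[OF indecomposables_permutes[OF that(7)] that(8,1)] that(4) by simp
    then show False
      using that(7) unfolding indecomposables_def decomposables_def by blast
  qed
  have perm: "\<sigma> permutes {1..i}" "\<sigma>' permutes {1..j}"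
    using assms(6,8) indecomposables_permutes by auto
  have ij: "i = j"
    using no_less[OF _ assms(1,2,5) perm(1) assms(7-9)]
      no_less[OF _ assms(1)[symmetric] assms(4,3) perm(2) assms(9,6,7)] by (metis linorder_neqE)
  have "\<sigma> x = \<sigma>' x" for x
  proof (cases "x \<le> i")
    case True then show ?thesis
      using fun_cong[OF assms(1), of x] ij by (simp add: direct_sum_def)
  next
    case False then show ?thesis
      using permutes_not_in[OF perm(1), of x] permutes_not_in[OF perm(2), of x] ij by simp
  qed
  moreover have "\<tau> x = \<tau>' x" for x
  proof (cases "x = 0")
    case True then show ?thesis
      using permutes_not_in[OF assms(7), of x] permutes_not_in[OF assms(9), of x] by simp
  next
    case False then show ?thesis
      using fun_cong[OF assms(1), of "i + x"] ij by (simp add: direct_sum_def)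
  qed
  ultimately show ?thesis using ij by auto
qed

text \<open>For surjectivity the cut is made at the least split, so that the first block is
  indecomposable.\<close>

lemma bij_betw_direct_sum:
  "bij_betw (\<lambda>(i, \<sigma>, \<tau>). direct_sum i \<sigma> \<tau>)
     (SIGMA i:{1..<n}. indecomposables i \<times> separable_perms (n - i)) (decomposables n)"
    (is "bij_betw ?f ?S _")
  unfolding bij_betw_def
proof
  show "inj_on ?f ?S"
  proof (rule inj_onI)
    fix p q assume pq: "p \<in> ?S" "q \<in> ?S" "?f p = ?f q"
    obtain i \<sigma> \<tau> j \<sigma>' \<tau>' where eq: "p = (i, \<sigma>, \<tau>)" "q = (j, \<sigma>', \<tau>')"
      by (metis prod_cases3)
    show "p = q"
      using direct_sum_inject[of i \<sigma> \<tau> j \<sigma>' \<tau>' n] pq separable_permutes unfolding eq by auto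
  qed
  show "?f ` ?S = decomposables n"
  proof (intro equalityI subsetI)
    fix \<sigma> assume "\<sigma> \<in> ?f ` ?S"
    then obtain i \<sigma>1 \<sigma>2 where *: "i \<in> {1..<n}" "\<sigma>1 \<in> indecomposables i" "\<sigma>2 \<in> separable_perms (n - i)"
      "\<sigma> = direct_sum i \<sigma>1 \<sigma>2" by auto
    have p: "\<sigma>1 permutes {1..i}" "\<sigma>2 permutes {1..n - i}"
      using * indecomposables_permutes separable_permutes by auto
    have "\<sigma> \<in> separable_perms n"
      using direct_sum_separable_iff[OF p] * by (simp add: indecomposables_def)
    moreover have "split_at n \<sigma> i" using split_at_direct_sum[OF p] * by (simp add: Suc_le_eq)
    ultimately show "\<sigma> \<in> decomposables n" unfolding decomposables_def by blast
  next
    fix \<sigma> assume "\<sigma> \<in> decomposables n"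
    then have sep: "\<sigma> \<in> separable_perms n" and ex: "\<exists>i. split_at n \<sigma> i"
      by (auto simp: decomposables_def)
    define i where "i = (LEAST i. split_at n \<sigma> i)"
    have split: "split_at n \<sigma> i" unfolding i_def using ex by (rule LeastI_ex)
    then have i: "1 \<le> i" "i < n" by (auto simp: split_at_def)
    obtain \<sigma>1 \<sigma>2 where *: "\<sigma>1 permutes {1..i}" "\<sigma>2 permutes {1..n - i}" "\<sigma> = direct_sum i \<sigma>1 \<sigma>2"
      using split_at_imp_direct_sum[OF separable_permutes[OF sep] split] .
    have s: "\<sigma>1 \<in> separable_perms i" "\<sigma>2 \<in> separable_perms (n - i)"
      using direct_sum_separable_iff[OF *(1,2)] sep i unfolding *(3) by simp_all
    have "\<not> split_at i \<sigma>1 j" for j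
    proof
      assume "split_at i \<sigma>1 j"
      moreover from this have "j < i" by (simp add: split_at_def)
      ultimately have "split_at n \<sigma> j"
        using split_at_direct_sum_less[OF *(1,2)] i unfolding *(3) by simp
      then show False using not_less_Least[of j "split_at n \<sigma>"] \<open>j < i\<close> by (simp add: i_def)
    qed
    then have "\<sigma>1 \<in> indecomposables i" using s by (auto simp: indecomposables_def decomposables_def)
    then show "\<sigma> \<in> ?f ` ?S" using i s(2) *(3) by (intro image_eqI[of _ _ "(i, \<sigma>1, \<sigma>2)"]) auto
  qed
qed

text \<open>Unique decomposition in the form used below: for a constant or additive weight the
  right-hand side becomes a convolution of coefficients.\<close>

lemma sum_decomposables:
  fixes w :: "(nat \<Rightarrow> nat) \<Rightarrow> 'a::comm_monoid_add"
  shows "sum w (decomposables n) =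
    (\<Sum>i\<in>{1..<n}. \<Sum>\<sigma>\<in>indecomposables i. \<Sum>\<tau>\<in>separable_perms (n - i). w (direct_sum i \<sigma> \<tau>))"
proof -
  let ?B = "\<lambda>i. indecomposables i \<times> separable_perms (n - i)"
  have "sum w (decomposables n) = (\<Sum>p\<in>Sigma {1..<n} ?B. w ((\<lambda>(i, \<sigma>, \<tau>). direct_sum i \<sigma> \<tau>) p))"
    by (rule sum.reindex_bij_betw[OF bij_betw_direct_sum, symmetric])
  also have "\<dots> = (\<Sum>(i, p)\<in>Sigma {1..<n} ?B. w (case p of (\<sigma>, \<tau>) \<Rightarrow> direct_sum i \<sigma> \<tau>))"
    by (intro sum.cong refl) auto
  also have "\<dots> = (\<Sum>i\<in>{1..<n}. \<Sum>p\<in>?B i. w (case p of (\<sigma>, \<tau>) \<Rightarrow> direct_sum i \<sigma> \<tau>))"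
    by (rule sum.Sigma[symmetric]) (simp_all add: finite_indecomposables finite_separable_perms)
  also have "\<dots> = (\<Sum>i\<in>{1..<n}. \<Sum>\<sigma>\<in>indecomposables i. \<Sum>\<tau>\<in>separable_perms (n - i). w (direct_sum i \<sigma> \<tau>))"
    by (intro sum.cong refl) (simp add: sum.cartesian_product case_prod_unfold)
  finally show ?thesis .
qed

text \<open>A direct and a skew split order the first and the last value in opposite ways.\<close>

lemma split_at_exclusive:
  assumes "split_at n \<sigma> i"
  shows "\<not> split_at n (\<lambda>x. - int (\<sigma> x)) j"
proof
  assume "split_at n (\<lambda>x. - int (\<sigma> x)) j"
  then have "\<sigma> n < \<sigma> 1" unfolding split_at_def by auto
  moreover have "\<sigma> 1 < \<sigma> n" using assms unfolding split_at_def by auto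
  ultimately show False by simp
qed

text \<open>From size 2 on, every separable permutation is exactly one of a direct sum and a skew
  sum (\<open>split_exists\<close>, \<open>split_at_exclusive\<close>), and complementation
  exchanges the two kinds.\<close>

lemma indecomposables_eq_flip:
  assumes "2 \<le> n"
  shows "indecomposables n = (\<lambda>\<sigma>. flip n \<circ> \<sigma>) ` decomposables n"
proof (intro equalityI subsetI)
  fix \<sigma> assume "\<sigma> \<in> indecomposables n"
  then have sep: "\<sigma> \<in> separable_perms n" and ns: "\<not> split_at n \<sigma> i" for i
    by (auto simp: indecomposables_def decomposables_def)
  have \<sigma>: "\<sigma> permutes {1..n}" "free_2413 n \<sigma>" "free_3142 n \<sigma>"
    using sep by (simp_all only: separable_perms_iff)
  have "\<exists>i. split_at n (\<lambda>x. int (\<sigma> x)) i \<or> split_at n (\<lambda>x. - int (\<sigma> x)) i"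
  proof (rule split_exists[OF assms])
    show "inj_on (\<lambda>x. int (\<sigma> x)) {1..n}" by (simp add: inj_on_def inj_eq[OF permutes_inj[OF \<sigma>(1)]])
    show "free_3142 n (\<lambda>x. int (\<sigma> x))" using \<sigma>(3) by (simp add: free_3142_def)
    show "free_3142 n (\<lambda>x. - int (\<sigma> x))" using \<sigma>(2) by (auto simp: free_3142_def free_2413_def)
  qed
  moreover have "split_at n (\<lambda>x. int (\<sigma> x)) i \<longleftrightarrow> split_at n \<sigma> i" for i
    by (simp add: split_at_def)
  ultimately obtain i where "split_at n (\<lambda>x. - int (\<sigma> x)) i" using ns by blast
  then have "flip n \<circ> \<sigma> \<in> decomposables n"
    using flip_separable[OF sep] split_at_flip[OF \<sigma>(1)] by (auto simp: decomposables_def)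
  then show "\<sigma> \<in> (\<lambda>\<sigma>. flip n \<circ> \<sigma>) ` decomposables n"
    by (rule image_eqI[rotated]) (simp add: flip_comp_flip)
next
  fix \<sigma> assume "\<sigma> \<in> (\<lambda>\<sigma>. flip n \<circ> \<sigma>) ` decomposables n"
  then obtain \<tau> i where \<tau>: "\<sigma> = flip n \<circ> \<tau>" "\<tau> \<in> separable_perms n" "split_at n \<tau> i"
    by (auto simp: decomposables_def)
  then have "\<not> split_at n \<sigma> j" for j
    using split_at_flip[OF separable_permutes[OF \<tau>(2)]] split_at_exclusive[OF \<tau>(3)] by blast
  then show "\<sigma> \<in> indecomposables n"
    using flip_separable[OF \<tau>(2)] \<tau>(1) by (auto simp: indecomposables_def decomposables_def)
qed

lemma inj_flip_comp: "inj_on (\<lambda>\<sigma>. flip n \<circ> \<sigma>) X"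
  by (rule inj_on_inverseI[of _ "\<lambda>\<sigma>. flip n \<circ> \<sigma>"]) (rule flip_comp_flip)

lemma sum_indecomposables_flip:
  assumes "2 \<le> n"
  shows "sum w (indecomposables n) = (\<Sum>\<sigma>\<in>decomposables n. w (flip n \<circ> \<sigma>))"
  unfolding indecomposables_eq_flip[OF assms] by (simp add: sum.reindex[OF inj_flip_comp])

lemma sum_separable_flip:
  "sum w (separable_perms n) = (\<Sum>\<sigma>\<in>separable_perms n. w (flip n \<circ> \<sigma>))"
proof -
  have "(\<lambda>\<sigma>. flip n \<circ> \<sigma>) ` separable_perms n = separable_perms n"
    using flip_separable by (force intro: image_eqI[of _ _ "flip n \<circ> _"] simp: flip_comp_flip)
  then have "sum w (separable_perms n) = sum w ((\<lambda>\<sigma>. flip n \<circ> \<sigma>) ` separable_perms n)" by simp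
  also have "\<dots> = (\<Sum>\<sigma>\<in>separable_perms n. w (flip n \<circ> \<sigma>))" by (simp add: sum.reindex[OF inj_flip_comp])
  finally show ?thesis .
qed

lemma separable_perms_1: "separable_perms 1 = {id}"
proof -
  have "separable_perms 1 \<subseteq> {id}"
    using separable_permutes by (fastforce simp: permutes_sing)
  then show ?thesis using separable_perms_nonempty[of 1] by blast
qed

lemma decomposables_1: "decomposables 1 = {}"
  by (auto simp: decomposables_def split_at_def)

lemma indecomposables_1: "indecomposables 1 = {id}"
  by (simp only: indecomposables_def separable_perms_1 decomposables_1 Diff_empty)

section \<open>Generating functions and their linear relations\<close>

text \<open>
  The empty permutation is excluded from the generating functions, so that the convolutions run over
  nonempty blocks only. By symmetry under \<^const>\<open>flip\<close>, skew sums and LIS are handled as direct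
  sums and LDS.
\<close>

definition sep_fps :: "real fps" where
  "sep_fps = Abs_fps (\<lambda>n. if n = 0 then 0 else real (card (separable_perms n)))"

definition indec_fps :: "real fps" where
  "indec_fps = Abs_fps (\<lambda>n. if n = 0 then 0 else real (card (indecomposables n)))"

definition lis_fps :: "real fps" where
  "lis_fps = Abs_fps (\<lambda>n. if n = 0 then 0 else \<Sum>\<sigma>\<in>separable_perms n. real (LIS n \<sigma>))"

definition indec_lis_fps :: "real fps" where
  "indec_lis_fps = Abs_fps (\<lambda>n. if n = 0 then 0 else \<Sum>\<sigma>\<in>indecomposables n. real (LIS n \<sigma>))"

definition indec_lds_fps :: "real fps" where
  "indec_lds_fps = Abs_fps (\<lambda>n. if n = 0 then 0 else \<Sum>\<sigma>\<in>indecomposables n. real (LDS n \<sigma>))"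

text \<open>Since a maximum is the sum minus the minimum, this is the deficit in
  \<open>LDS_direct_sum\<close> against additivity, summed over all direct sums of size
  \<open>n\<close>; by complementation it is also that of LIS over skew sums.\<close>

definition loss_fps :: "real fps" where
  "loss_fps = Abs_fps (\<lambda>n. \<Sum>i\<in>{1..<n}. \<Sum>\<sigma>\<in>indecomposables i. \<Sum>\<tau>\<in>separable_perms (n - i).
     real (min (LDS i \<sigma>) (LDS (n - i) \<tau>)))"

lemma fps_mult_nth_no_const:
  fixes F G :: "'a::comm_semiring_0 fps"
  assumes "fps_nth F 0 = 0" "fps_nth G 0 = 0"
  shows "fps_nth (F * G) n = (\<Sum>i\<in>{1..<n}. fps_nth F i * fps_nth G (n - i))"
  unfolding fps_mult_nth
proof (rule sum.mono_neutral_right)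
  show "\<forall>i\<in>{0..n} - {1..<n}. fps_nth F i * fps_nth G (n - i) = 0"
  proof
    fix i assume "i \<in> {0..n} - {1..<n}"
    then have "i = 0 \<or> i = n" by auto
    then show "fps_nth F i * fps_nth G (n - i) = 0" using assms by auto
  qed
qed auto

lemma sum_sum_add:
  fixes w v :: "'b \<Rightarrow> 'a::comm_semiring_1"
  shows "(\<Sum>x\<in>I. \<Sum>y\<in>J. w x + v y) = sum w I * of_nat (card J) + of_nat (card I) * sum v J"
  by (simp add: sum.distrib sum_distrib_left sum_distrib_right mult.commute)

lemma sum_lds_separable:
  "(\<Sum>\<sigma>\<in>separable_perms n. real (LDS n \<sigma>)) = (\<Sum>\<sigma>\<in>separable_perms n. real (LIS n \<sigma>))"
  unfolding sum_separable_flip[of "\<lambda>\<sigma>. real (LDS n \<sigma>)"]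
  by (intro sum.cong refl) (simp add: LDS_flip[OF separable_permutes])

lemma sep_fps_eq: "sep_fps = indec_fps + indec_fps * sep_fps"
proof (rule fps_ext)
  fix n
  have "fps_nth (indec_fps * sep_fps) n = (\<Sum>\<sigma>\<in>decomposables n. 1)"
    unfolding sum_decomposables
    by (subst fps_mult_nth_no_const) (auto simp: indec_fps_def sep_fps_def intro!: sum.cong)
  then show "fps_nth sep_fps n = fps_nth (indec_fps + indec_fps * sep_fps) n"
    using sum_separable_eq[of "\<lambda>_. 1::real" n]
    by (auto simp: indec_fps_def sep_fps_def decomposables_def separable_permutes split_at_def)
qed

text \<open>From size 2 on, complementation shows that exactly half of the separable permutations
  are indecomposable; \<open>fps_X\<close> corrects size 1.\<close>

lemma indec_fps_eq: "indec_fps + indec_fps = sep_fps + fps_X"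
proof (rule fps_ext)
  fix n :: nat
  consider "n = 0" | "n = 1" | "2 \<le> n" by linarith
  then show "fps_nth (indec_fps + indec_fps) n = fps_nth (sep_fps + fps_X) n"
  proof cases
    case 2
    then show ?thesis
      using separable_perms_1 indecomposables_1 by (simp add: indec_fps_def sep_fps_def)
  next
    case 3
    then show ?thesis
      using sum_separable_eq[of "\<lambda>_. 1::real" n] sum_indecomposables_flip[of n "\<lambda>_. 1::real"]
      by (simp add: indec_fps_def sep_fps_def)
  qed (simp add: indec_fps_def sep_fps_def)
qed

lemma lis_fps_eq:
  "lis_fps = indec_lis_fps + indec_lis_fps * sep_fps + indec_fps * lis_fps"
proof (rule fps_ext)
  fix n
  have "fps_nth (indec_lis_fps * sep_fps) n + fps_nth (indec_fps * lis_fps) n =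
    (\<Sum>i\<in>{1..<n}. \<Sum>\<sigma>\<in>indecomposables i. \<Sum>\<tau>\<in>separable_perms (n - i). real (LIS i \<sigma>) + real (LIS (n - i) \<tau>))"
    by (subst (1 2) fps_mult_nth_no_const)
       (auto simp: sum_sum_add indec_fps_def sep_fps_def lis_fps_def indec_lis_fps_def sum.distrib[symmetric]
         intro!: sum.cong)
  also have "\<dots> = (\<Sum>\<sigma>\<in>decomposables n. real (LIS n \<sigma>))"
    unfolding sum_decomposables
  proof (intro sum.cong refl)
    fix i \<sigma> \<tau> assume "i \<in> {1..<n}" "\<sigma> \<in> indecomposables i" "\<tau> \<in> separable_perms (n - i)"
    then show "real (LIS i \<sigma>) + real (LIS (n - i) \<tau>) = real (LIS n (direct_sum i \<sigma> \<tau>))"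
      using LIS_direct_sum[OF indecomposables_permutes separable_permutes, of \<sigma> i \<tau> "n - i"] by simp
  qed
  finally show "fps_nth lis_fps n = fps_nth (indec_lis_fps + indec_lis_fps * sep_fps + indec_fps * lis_fps) n"
    using sum_separable_eq[of "\<lambda>\<sigma>. real (LIS n \<sigma>)" n]
    by (cases "n = 0") (simp_all add: lis_fps_def indec_lis_fps_def indec_fps_def)
qed

text \<open>The counterpart of \<open>lis_fps_eq\<close> for LDS. The total of LDS over all
  separable permutations is again \<open>lis_fps\<close>, by complementation.\<close>

lemma lis_fps_eq_loss:
  "lis_fps = indec_lds_fps + indec_lds_fps * sep_fps + indec_fps * lis_fps - loss_fps"
proof (rule fps_ext)
  fix n
  have "fps_nth (indec_lds_fps * sep_fps) n + fps_nth (indec_fps * lis_fps) n =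
    (\<Sum>i\<in>{1..<n}. \<Sum>\<sigma>\<in>indecomposables i. \<Sum>\<tau>\<in>separable_perms (n - i). real (LDS i \<sigma>) + real (LDS (n - i) \<tau>))"
    by (subst (1 2) fps_mult_nth_no_const)
       (auto simp: sum_sum_add indec_fps_def sep_fps_def lis_fps_def indec_lds_fps_def sum_lds_separable sum.distrib[symmetric]
         intro!: sum.cong)
  moreover have "(\<Sum>\<sigma>\<in>decomposables n. real (LDS n \<sigma>)) =
    (\<Sum>i\<in>{1..<n}. \<Sum>\<sigma>\<in>indecomposables i. \<Sum>\<tau>\<in>separable_perms (n - i).
      real (LDS i \<sigma>) + real (LDS (n - i) \<tau>) - real (min (LDS i \<sigma>) (LDS (n - i) \<tau>)))"
    unfolding sum_decomposables
  proof (intro sum.cong refl)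
    fix i \<sigma> \<tau> assume "i \<in> {1..<n}" "\<sigma> \<in> indecomposables i" "\<tau> \<in> separable_perms (n - i)"
    then show "real (LDS n (direct_sum i \<sigma> \<tau>)) =
        real (LDS i \<sigma>) + real (LDS (n - i) \<tau>) - real (min (LDS i \<sigma>) (LDS (n - i) \<tau>))"
      using LDS_direct_sum[OF indecomposables_permutes separable_permutes, of \<sigma> i \<tau> "n - i"]
      by (simp add: max_def min_def)
  qed
  ultimately have "fps_nth (indec_lds_fps * sep_fps) n + fps_nth (indec_fps * lis_fps) n - fps_nth loss_fps n
      = (\<Sum>\<sigma>\<in>decomposables n. real (LDS n \<sigma>))"
    by (simp add: loss_fps_def sum_subtractf)
  then show "fps_nth lis_fps n =
      fps_nth (indec_lds_fps + indec_lds_fps * sep_fps + indec_fps * lis_fps - loss_fps) n"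
    using sum_separable_eq[of "\<lambda>\<sigma>. real (LDS n \<sigma>)" n] sum_lds_separable[of n]
    by (cases "n = 0") (simp_all add: lis_fps_def indec_lds_fps_def indec_fps_def loss_fps_def)
qed

text \<open>From size 2 on, LDS over indecomposables has the same total as LIS over decomposables.
  The single permutation of size 1 is counted twice on the right, whence
  \<open>fps_X\<close>.\<close>

lemma lis_fps_X: "lis_fps + fps_X = indec_lds_fps + indec_lis_fps"
proof (rule fps_ext)
  fix n :: nat
  consider "n = 0" | "n = 1" | "2 \<le> n" by linarith
  then show "fps_nth (lis_fps + fps_X) n = fps_nth (indec_lds_fps + indec_lis_fps) n"
  proof cases
    case 2
    then show ?thesis
      using separable_perms_1 indecomposables_1 LIS_1 LDS_1
      by (simp add: lis_fps_def indec_lds_fps_def indec_lis_fps_def)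
  next
    case 3
    have "(\<Sum>\<sigma>\<in>indecomposables n. real (LDS n \<sigma>)) = (\<Sum>\<sigma>\<in>decomposables n. real (LIS n \<sigma>))"
      unfolding sum_indecomposables_flip[OF 3]
      using decomposables_subset by (intro sum.cong refl) (simp add: LDS_flip[OF separable_permutes] subset_iff)
    then show ?thesis
      using 3 sum_separable_eq[of "\<lambda>\<sigma>. real (LIS n \<sigma>)" n]
      by (simp add: lis_fps_def indec_lds_fps_def indec_lis_fps_def)
  qed (simp add: lis_fps_def indec_lds_fps_def indec_lis_fps_def)
qed

section \<open>The Delannoy kernel and the loss series\<close>

text \<open>The quadratic equation of the large Schroeder numbers 1, 2, 6, 22.\<close>

lemma sep_fps_quadratic: "2 * sep_fps = (sep_fps + fps_X) * (1 + sep_fps)"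
proof -
  have "2 * sep_fps = (indec_fps + indec_fps) * (1 + sep_fps)"
    using sep_fps_eq by algebra
  then show ?thesis by (simp only: indec_fps_eq)
qed

text \<open>Adding the two expressions for \<open>lis_fps\<close> leaves only the sum of
  \<open>indec_lds_fps\<close> and \<open>indec_lis_fps\<close>, which \<open>lis_fps_X\<close>
  eliminates.\<close>

lemma lis_fps_quadratic: "lis_fps * (1 - fps_X - 2 * sep_fps) = fps_X * (1 + sep_fps) - loss_fps"
proof -
  have "lis_fps + (lis_fps + loss_fps) = (indec_lds_fps + indec_lis_fps) * (1 + sep_fps) + (indec_fps + indec_fps) * lis_fps"
    using lis_fps_eq lis_fps_eq_loss by (simp add: algebra_simps)
  also have "\<dots> = (lis_fps + fps_X) * (1 + sep_fps) + (sep_fps + fps_X) * lis_fps"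
    by (simp only: lis_fps_X indec_fps_eq)
  finally show ?thesis by algebra
qed

section \<open>The central Delannoy numbers\<close>

definition delannoy_fps :: "real fps" where
  "delannoy_fps = inverse (1 - fps_X - 2 * sep_fps)"

lemma delannoy_fps_inverse: "delannoy_fps * (1 - fps_X - 2 * sep_fps) = 1"
  unfolding delannoy_fps_def by (rule inverse_mult_eq_1) (simp add: sep_fps_def)

text \<open>Up to sign, \<open>1 - fps_X - 2 * sep_fps\<close> is the derivative of the quadratic at
  its root, so its square is the discriminant. This gives the series for
  \<open>1 / sqrt (1 - 6 x + x^2)\<close> without taking a root of a power series.\<close>

lemma discriminant: "(1 - fps_X - 2 * sep_fps)\<^sup>2 = 1 - 6 * fps_X + fps_X\<^sup>2"
  using sep_fps_quadratic by algebra

lemma delannoy_fps_square: "delannoy_fps * delannoy_fps * (1 - 6 * fps_X + fps_X\<^sup>2) = 1"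
  using delannoy_fps_inverse discriminant by algebra

lemma lis_fps_explicit: "lis_fps = delannoy_fps * (fps_X * (1 + sep_fps) - loss_fps)"
  using delannoy_fps_inverse lis_fps_quadratic by algebra

text \<open>Implicit differentiation of the quadratic equation.\<close>

lemma sep_fps_deriv: "fps_deriv sep_fps = delannoy_fps * (1 + sep_fps)"
proof -
  have "fps_deriv (2 * sep_fps) = fps_deriv ((sep_fps + fps_X) * (1 + sep_fps))"
    by (simp only: sep_fps_quadratic)
  then have "2 * fps_deriv sep_fps = (sep_fps + fps_X) * fps_deriv sep_fps + (fps_deriv sep_fps + 1) * (1 + sep_fps)"
    by simp
  then show ?thesis using delannoy_fps_inverse by algebra
qed

text \<open>The derivative contributes the same term \<open>fps_X * (1 + sep_fps)\<close> as
  \<open>lis_fps_explicit\<close>, so only the loss survives. The coefficients on the left are the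
  totals of size minus LIS.\<close>

lemma size_minus_lis_fps: "fps_X * fps_deriv sep_fps - lis_fps = delannoy_fps * loss_fps"
  by (simp add: sep_fps_deriv lis_fps_explicit algebra_simps)

lemma size_fps_eq: "2 * (fps_X * fps_deriv sep_fps) = 3 * (fps_X * delannoy_fps) - fps_X * (fps_X * delannoy_fps) - fps_X"
  using delannoy_fps_inverse sep_fps_deriv by algebra

text \<open>The differential equation of \<open>(1 - 6 x + x^2)\<close> to the power -1/2, obtained
  by differentiating both the product \<open>delannoy_fps * R = 1\<close> and the square of
  \<open>R\<close>.\<close>

lemma delannoy_fps_ode: "fps_deriv delannoy_fps * (1 - 6 * fps_X + fps_X\<^sup>2) = (3 - fps_X) * delannoy_fps"
proof -
  define R :: "real fps" where "R = 1 - fps_X - 2 * sep_fps"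
  have 1: "delannoy_fps * R = 1" unfolding R_def by (rule delannoy_fps_inverse)
  have 2: "R\<^sup>2 = 1 - 6 * fps_X + fps_X\<^sup>2" unfolding R_def by (rule discriminant)
  have "fps_deriv (delannoy_fps * R) = 0" by (simp add: 1)
  then have 3: "delannoy_fps * fps_deriv R + fps_deriv delannoy_fps * R = 0" by simp
  have "fps_deriv (R\<^sup>2) = fps_deriv (1 - 6 * fps_X + fps_X\<^sup>2)" by (simp only: 2)
  then have "2 * (R * fps_deriv R) = 2 * (fps_X - 3)"
    by (simp add: power2_eq_square algebra_simps)
  then have 4: "R * fps_deriv R = fps_X - 3" by (simp only: mult_cancel_left) simp
  show ?thesis using 1 2 3 4 by algebra
qed

abbreviation dl :: "nat \<Rightarrow> real" where "dl n \<equiv> fps_nth delannoy_fps n"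
abbreviation loss :: "nat \<Rightarrow> real" where "loss n \<equiv> fps_nth loss_fps n"

lemma dl_0: "dl 0 = 1"
  by (simp add: delannoy_fps_def sep_fps_def)

lemma delannoy_fps_ode':
  "fps_deriv delannoy_fps - fps_const 6 * (fps_X * fps_deriv delannoy_fps)
     + fps_X * (fps_X * fps_deriv delannoy_fps) = fps_const 3 * delannoy_fps - fps_X * delannoy_fps"
  using delannoy_fps_ode unfolding numeral_fps_const[symmetric] by algebra

lemma dl_rec: "real (n + 2) * dl (n + 2) = (6 * real n + 9) * dl (n + 1) - real (n + 1) * dl n"
  using arg_cong[OF delannoy_fps_ode', of "\<lambda>F. fps_nth F (n + 1)"]
  by (cases n) (simp_all add: algebra_simps)

lemma dl_1: "dl 1 = 3"
  using arg_cong[OF delannoy_fps_ode', of "\<lambda>F. fps_nth F 0"] by (simp add: dl_0)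

text \<open>The smaller zero of the discriminant, and so the dominant singularity of
  \<open>sep_fps\<close> and \<open>delannoy_fps\<close>.\<close>

definition rho :: real where "rho = 3 - 2 * sqrt 2"

lemma rho_quadratic: "rho * (6 - rho) = 1"
  by (simp add: rho_def algebra_simps)

lemma rho_pos: "0 < rho"
proof -
  have "sqrt 2 < sqrt ((3/2)\<^sup>2)" by (subst real_sqrt_less_iff) (simp add: power2_eq_square)
  then show ?thesis by (simp add: rho_def)
qed

lemma rho_less_1: "rho < 1"
  by (simp add: rho_def)

lemma rho_le_third: "3 * rho \<le> 1"
proof -
  have "sqrt 2 > 4/3" by (rule real_less_rsqrt) (simp add: power2_eq_square)
  then show ?thesis unfolding rho_def by simp
qed

text \<open>A simultaneous induction through the recurrence. Monotonicity follows from
  \<open>dl n \<le> dl (Suc n)\<close>. For the ratio, \<open>rho * dl (Suc n) \<le> dl n\<close>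
  makes the recurrence factor at most \<open>(n + 1) * (6 - rho) + 3\<close>; after multiplication
  by \<open>rho\<close> this is \<open>n + 1 + 3 * rho\<close>, which is at most
  \<open>n + 2\<close> by \<open>rho_le_third\<close>.\<close>

lemma dl_bounds: "0 < dl n \<and> dl n \<le> dl (Suc n) \<and> rho * dl (Suc n) \<le> dl n"
proof (induction n)
  case 0
  show ?case using dl_0 dl_1 rho_le_third by simp
next
  case (Suc n)
  let ?x = "dl (Suc n)"
  have x: "0 < ?x" "dl n \<le> ?x" "rho * ?x \<le> dl n" using Suc.IH by auto
  have rec: "real (n + 2) * dl (Suc (Suc n)) = (6 * real n + 9) * ?x - real (n + 1) * dl n"
    using dl_rec[of n] by simp
  have "real (n + 1) * dl n \<le> real (n + 1) * ?x" using x by (intro mult_left_mono) auto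
  moreover have "real (n + 2) * ?x \<le> (6 * real n + 9) * ?x - real (n + 1) * ?x"
  proof -
    have "0 \<le> (4 * real n + 6) * ?x" using x by simp
    then show ?thesis by (simp add: algebra_simps)
  qed
  ultimately have "real (n + 2) * ?x \<le> real (n + 2) * dl (Suc (Suc n))" using rec by linarith
  then have 1: "?x \<le> dl (Suc (Suc n))" by simp
  have "real (n + 1) * (rho * ?x) \<le> real (n + 1) * dl n" using x by (intro mult_left_mono) auto
  then have "real (n + 2) * dl (Suc (Suc n)) \<le> (6 * real n + 9 - real (n + 1) * rho) * ?x"
    using rec by (simp add: algebra_simps)
  then have "rho * (real (n + 2) * dl (Suc (Suc n))) \<le> rho * ((6 * real n + 9 - real (n + 1) * rho) * ?x)"
    using rho_pos by (intro mult_left_mono) auto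
  also have "\<dots> = (real (n + 1) * (rho * (6 - rho)) + 3 * rho) * ?x" by (simp add: algebra_simps)
  also have "\<dots> = (real (n + 1) + 3 * rho) * ?x" by (simp only: rho_quadratic mult_1_right)
  also have "\<dots> \<le> real (n + 2) * ?x"
    using x rho_le_third by (intro mult_right_mono) auto
  finally have "real (n + 2) * (rho * dl (Suc (Suc n))) \<le> real (n + 2) * ?x" by (simp only: mult_ac)
  then have "rho * dl (Suc (Suc n)) \<le> ?x" by simp
  then show ?case using x(1) 1 by simp
qed

lemma dl_pos: "0 < dl n" using dl_bounds by blast

lemma dl_mono_rho: "rho ^ k * dl (n + k) \<le> dl n"
proof (induction k)
  case (Suc k)
  have "rho ^ Suc k * dl (n + Suc k) = rho ^ k * (rho * dl (Suc (n + k)))" by simp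
  also have "\<dots> \<le> rho ^ k * dl (n + k)" using dl_bounds[of "n + k"] rho_pos by (intro mult_left_mono) auto
  finally show ?case using Suc by linarith
qed simp

section \<open>Partial sums of Cauchy products at \<open>rho\<close>\<close>

lemma sum_cauchy_le:
  fixes f g :: "nat \<Rightarrow> real"
  assumes "\<And>i. 0 \<le> f i" "\<And>i. 0 \<le> g i"
  shows "(\<Sum>n\<le>N. \<Sum>i\<le>n. f i * g (n - i)) \<le> (\<Sum>i\<le>N. f i) * (\<Sum>i\<le>N. g i)"
proof -
  have "(\<Sum>n\<le>N. \<Sum>i\<le>n. f i * g (n - i)) = (\<Sum>(i, j)\<in>{(i, j). i + j \<le> N}. f i * g j)"
    by (rule sum.triangle_reindex_eq[symmetric])
  also have "\<dots> \<le> (\<Sum>(i, j)\<in>{..N} \<times> {..N}. f i * g j)"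
    using assms by (intro sum_mono2) auto
  also have "\<dots> = (\<Sum>i\<le>N. f i) * (\<Sum>i\<le>N. g i)"
    by (simp add: sum_product sum.cartesian_product)
  finally show ?thesis .
qed

text \<open>The rectangle of index pairs lies inside the triangle of degree \<open>M + N\<close>,
  whereas \<open>sum_cauchy_le\<close> uses that a triangle lies inside a square.\<close>

lemma sum_cauchy_ge:
  fixes f g :: "nat \<Rightarrow> real"
  assumes "\<And>i. 0 \<le> f i" "\<And>i. 0 \<le> g i"
  shows "(\<Sum>i\<le>M. f i) * (\<Sum>i\<le>N. g i) \<le> (\<Sum>n\<le>M + N. \<Sum>i\<le>n. f i * g (n - i))"
proof -
  have fin: "finite {(i, j). i + j \<le> M + N}"
    by (rule finite_subset[of _ "{..M + N} \<times> {..M + N}"]) auto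
  have "(\<Sum>i\<le>M. f i) * (\<Sum>i\<le>N. g i) = (\<Sum>(i, j)\<in>{..M} \<times> {..N}. f i * g j)"
    by (simp add: sum_product sum.cartesian_product)
  also have "\<dots> \<le> (\<Sum>(i, j)\<in>{(i, j). i + j \<le> M + N}. f i * g j)"
    using assms fin by (intro sum_mono2) auto
  also have "\<dots> = (\<Sum>n\<le>M + N. \<Sum>i\<le>n. f i * g (n - i))"
    by (rule sum.triangle_reindex_eq)
  finally show ?thesis .
qed

lemma fps_mult_nth_scaled:
  "fps_nth (F * G) n * c ^ n = (\<Sum>i\<le>n. (fps_nth F i * c ^ i) * (fps_nth G (n - i) * c ^ (n - i)))"
  for c :: "'a::comm_semiring_1"
proof -
  have "fps_nth F i * fps_nth G (n - i) * c ^ n = (fps_nth F i * c ^ i) * (fps_nth G (n - i) * c ^ (n - i))"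
    if "i \<le> n" for i
  proof -
    have "c ^ n = c ^ i * c ^ (n - i)" using that by (simp flip: power_add)
    then show ?thesis by (simp add: mult_ac)
  qed
  then show ?thesis by (simp add: fps_mult_nth sum_distrib_right atMost_atLeast0)
qed

lemma delannoy_square_lower: "1 \<le> fps_nth (delannoy_fps * delannoy_fps) n * rho ^ n"
proof -
  define E where "E = delannoy_fps * delannoy_fps"
  define e where "e = fps_nth E"
  have E: "E - fps_const 6 * (fps_X * E) + fps_X * (fps_X * E) = 1"
    using delannoy_fps_square unfolding E_def numeral_fps_const[symmetric] by algebra
  have e0: "e 0 = 1" by (simp add: e_def E_def dl_0)
  have e1: "e 1 = 6"
    using arg_cong[OF E, of "\<lambda>F. fps_nth F 1"] e0
    by (simp add: e_def)
  have rec: "e (Suc (Suc n)) = 6 * e (Suc n) - e n" for n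
    using arg_cong[OF E, of "\<lambda>F. fps_nth F (Suc (Suc n))"]
    by (simp add: e_def)
  \<comment> \<open>The discriminant factors as \<open>(1 - rho x) (1 - x / rho)\<close>. Cancelling
    the second factor from its inverse leaves a geometric series of ratio \<open>rho\<close>; as its
    terms are positive, \<open>e n * rho ^ n\<close> increases.\<close>
  have diff: "rho * e (Suc n) - e n = rho ^ (n + 2)" for n
  proof (induction n)
    case 0
    have "rho * 6 - 1 = rho * rho" using rho_quadratic by (simp add: algebra_simps)
    then show ?case using e0 e1 by (simp add: power2_eq_square)
  next
    case (Suc n)
    have "rho * e (Suc (Suc n)) - e (Suc n) = (rho * 6 - 1) * e (Suc n) - rho * e n"
      by (simp add: rec algebra_simps)
    also have "rho * 6 - 1 = rho * rho" using rho_quadratic by (simp add: algebra_simps)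
    also have "rho * rho * e (Suc n) - rho * e n = rho * (rho * e (Suc n) - e n)" by (simp add: algebra_simps)
    finally show ?case by (simp add: Suc.IH)
  qed
  have "1 \<le> e n * rho ^ n"
  proof (induction n)
    case 0 then show ?case by (simp add: e0)
  next
    case (Suc n)
    have "e n \<le> rho * e (Suc n)" using diff[of n] rho_pos by (smt (verit) zero_less_power)
    then have "e n * rho ^ n \<le> rho * e (Suc n) * rho ^ n" using rho_pos by (intro mult_right_mono) auto
    then show ?case using Suc by (simp add: mult_ac)
  qed
  then show ?thesis by (simp only: e_def E_def)
qed

text \<open>The square of the partial sum dominates the partial sum of the squared series, each of
  whose terms is at least 1.\<close>

lemma sum_dl_lower: "sqrt (real (Suc N)) \<le> (\<Sum>j\<le>N. dl j * rho ^ j)"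
proof (rule real_le_lsqrt)
  have pos: "0 \<le> dl i * rho ^ i" for i using dl_pos[of i] rho_pos by simp
  have "real (Suc N) = (\<Sum>n\<le>N. 1)" by simp
  also have "\<dots> \<le> (\<Sum>n\<le>N. fps_nth (delannoy_fps * delannoy_fps) n * rho ^ n)"
    by (intro sum_mono delannoy_square_lower)
  also have "\<dots> = (\<Sum>n\<le>N. \<Sum>i\<le>n. (dl i * rho ^ i) * (dl (n - i) * rho ^ (n - i)))"
    by (simp only: fps_mult_nth_scaled)
  also have "\<dots> \<le> (\<Sum>j\<le>N. dl j * rho ^ j) * (\<Sum>j\<le>N. dl j * rho ^ j)"
    by (rule sum_cauchy_le) (rule pos)+
  finally show "real (Suc N) \<le> (\<Sum>j\<le>N. dl j * rho ^ j)\<^sup>2" by (simp add: power2_eq_square)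
  show "0 \<le> (\<Sum>j\<le>N. dl j * rho ^ j)" using pos by (intro sum_nonneg) auto
qed

section \<open>Tail counts of LDS and their relation to the loss\<close>

definition lds_tail :: "nat \<Rightarrow> nat \<Rightarrow> real" where
  "lds_tail s n = (\<Sum>\<sigma>\<in>separable_perms n. of_bool (s < LDS n \<sigma>))"

definition indec_lds_tail :: "nat \<Rightarrow> nat \<Rightarrow> real" where
  "indec_lds_tail s n = (\<Sum>\<sigma>\<in>indecomposables n. of_bool (s < LDS n \<sigma>))"

text \<open>The layer-cake formula: it turns totals of LDS, and of minima of two LDS values, into
  sums of tail counts.\<close>

lemma sum_of_bool_less: "(\<Sum>s<N. of_bool (s < m)) = real (min m N)"
proof -
  have "{..<N} \<inter> {s. s < m} = {..<min m N}" by auto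
  then show ?thesis by (simp add: sum.If_cases of_bool_def)
qed

lemma LDS_0: "LDS 0 \<sigma> = 0"
  using LDS_le[of 0 \<sigma>] by simp

lemma lds_tail_0: "lds_tail s 0 = 0" "indec_lds_tail s 0 = 0"
  by (simp_all add: lds_tail_def indec_lds_tail_def LDS_0)

lemma lds_tail_nonneg: "0 \<le> lds_tail s n" "0 \<le> indec_lds_tail s n"
  unfolding lds_tail_def indec_lds_tail_def by (intro sum_nonneg; simp)+

lemma lis_fps_nth: "fps_nth lis_fps n = (\<Sum>\<sigma>\<in>separable_perms n. real (LIS n \<sigma>))"
  using LIS_le[of 0] by (simp add: lis_fps_def)

lemma lis_fps_nth_tail:
  assumes "n \<le> N"
  shows "fps_nth lis_fps n = (\<Sum>s<N. lds_tail s n)"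
proof -
  have "(\<Sum>s<N. lds_tail s n) = (\<Sum>\<sigma>\<in>separable_perms n. \<Sum>s<N. of_bool (s < LDS n \<sigma>))"
    unfolding lds_tail_def by (rule sum.swap)
  also have "\<dots> = (\<Sum>\<sigma>\<in>separable_perms n. real (LDS n \<sigma>))"
  proof (rule sum.cong[OF refl])
    fix \<sigma> show "(\<Sum>s<N. of_bool (s < LDS n \<sigma>)) = real (LDS n \<sigma>)"
      unfolding sum_of_bool_less using LDS_le[of n \<sigma>] assms by (simp add: min_def)
  qed
  finally show ?thesis by (simp add: lis_fps_nth sum_lds_separable)
qed

text \<open>After complementation, putting a new minimum in front does not decrease LIS and yields a
  decomposable permutation, the summand \<open>i = 1\<close> of \<open>sum_decomposables\<close>.
  Complementing back makes it indecomposable.\<close>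

lemma lds_tail_le_indec: "lds_tail s n \<le> indec_lds_tail s (Suc n)"
proof (cases "n = 0")
  case True then show ?thesis by (simp add: lds_tail_0 lds_tail_nonneg)
next
  case False
  have id: "id permutes {1..1::nat}" by (rule permutes_id)
  have ge: "LIS n \<tau> \<le> LIS (Suc n) (direct_sum 1 id \<tau>)" if "\<tau> \<in> separable_perms n" for \<tau>
    using LIS_direct_sum[OF id separable_permutes[OF that]] by simp
  have "lds_tail s n = (\<Sum>\<tau>\<in>separable_perms n. of_bool (s < LIS n \<tau>))"
    unfolding lds_tail_def sum_separable_flip[of "\<lambda>\<sigma>. of_bool (s < LDS n \<sigma>)"]
    by (intro sum.cong refl) (simp add: LDS_flip[OF separable_permutes])
  also have "\<dots> \<le> (\<Sum>\<tau>\<in>separable_perms n. of_bool (s < LIS (Suc n) (direct_sum 1 id \<tau>)))"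
    by (intro sum_mono) (use ge in \<open>auto dest: less_le_trans\<close>)
  also have "\<dots> = (\<Sum>\<sigma>\<in>indecomposables 1. \<Sum>\<tau>\<in>separable_perms (Suc n - 1). of_bool (s < LIS (Suc n) (direct_sum 1 \<sigma> \<tau>)))"
    by (simp only: indecomposables_1) simp
  also have "\<dots> \<le> (\<Sum>i\<in>{1..<Suc n}. \<Sum>\<sigma>\<in>indecomposables i. \<Sum>\<tau>\<in>separable_perms (Suc n - i). of_bool (s < LIS (Suc n) (direct_sum i \<sigma> \<tau>)))"
    using False by (intro member_le_sum[where i = 1] sum_nonneg) auto
  also have "\<dots> = (\<Sum>\<sigma>\<in>decomposables (Suc n). of_bool (s < LIS (Suc n) \<sigma>))"
    by (rule sum_decomposables[symmetric])
  also have "\<dots> = (\<Sum>\<sigma>\<in>decomposables (Suc n). of_bool (s < LDS (Suc n) (flip (Suc n) \<circ> \<sigma>)))"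
    using decomposables_subset by (intro sum.cong refl) (simp add: LDS_flip[OF separable_permutes] subset_iff)
  also have "\<dots> = indec_lds_tail s (Suc n)"
    unfolding indec_lds_tail_def using False
    by (subst sum_indecomposables_flip[of "Suc n" "\<lambda>\<sigma>. of_bool (s < LDS (Suc n) \<sigma>)"]) auto
  finally show ?thesis .
qed

text \<open>Both LDS values exceed \<open>s\<close> exactly when their minimum does, so summing the
  products of tails over \<open>s < M\<close> counts each minimum, truncated at
  \<open>M\<close>.\<close>

lemma lds_tail_loss: "(\<Sum>s<M. \<Sum>i\<le>n. indec_lds_tail s i * lds_tail s (n - i)) \<le> loss n"
proof -
  have "(\<Sum>i\<le>n. indec_lds_tail s i * lds_tail s (n - i)) =
    (\<Sum>i\<in>{1..<n}. \<Sum>\<sigma>\<in>indecomposables i. \<Sum>\<tau>\<in>separable_perms (n - i). of_bool (s < min (LDS i \<sigma>) (LDS (n - i) \<tau>)))" for s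
  proof -
    have "(\<Sum>i\<le>n. indec_lds_tail s i * lds_tail s (n - i)) = fps_nth (Abs_fps (indec_lds_tail s) * Abs_fps (lds_tail s)) n"
      by (simp add: fps_mult_nth atMost_atLeast0)
    also have "\<dots> = (\<Sum>i\<in>{1..<n}. indec_lds_tail s i * lds_tail s (n - i))"
      by (subst fps_mult_nth_no_const) (simp_all add: lds_tail_0)
    also have "\<dots> = (\<Sum>i\<in>{1..<n}. \<Sum>\<sigma>\<in>indecomposables i. \<Sum>\<tau>\<in>separable_perms (n - i). of_bool (s < min (LDS i \<sigma>) (LDS (n - i) \<tau>)))"
      by (simp add: indec_lds_tail_def lds_tail_def sum_product of_bool_conj del: of_bool_eq_iff)
    finally show ?thesis .
  qed
  then have "(\<Sum>s<M. \<Sum>i\<le>n. indec_lds_tail s i * lds_tail s (n - i)) =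
    (\<Sum>s<M. \<Sum>i\<in>{1..<n}. \<Sum>\<sigma>\<in>indecomposables i. \<Sum>\<tau>\<in>separable_perms (n - i). of_bool (s < min (LDS i \<sigma>) (LDS (n - i) \<tau>)))"
    by simp
  also have "\<dots> = (\<Sum>i\<in>{1..<n}. \<Sum>\<sigma>\<in>indecomposables i. \<Sum>\<tau>\<in>separable_perms (n - i). \<Sum>s<M. of_bool (s < min (LDS i \<sigma>) (LDS (n - i) \<tau>)))"
    by (subst sum.swap, rule sum.cong[OF refl], subst sum.swap, rule sum.cong[OF refl], rule sum.swap)
  also have "\<dots> \<le> loss n"
    unfolding sum_of_bool_less loss_fps_def fps_nth_Abs_fps by (intro sum_mono of_nat_mono min.cobounded1)
  finally show ?thesis .
qed

lemma loss_nonneg: "0 \<le> loss n"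
  by (simp add: loss_fps_def sum_nonneg)

lemma loss_0: "loss 0 = 0"
  by (simp add: loss_fps_def)

text \<open>One tail factor is replaced by an indecomposable one through
  \<open>lds_tail_le_indec\<close>; the size increase by one costs the factor \<open>rho\<close> and
  makes the degree \<open>(N + 1) + N\<close>.\<close>

lemma sum_lds_tail_square:
  "rho * (\<Sum>s<M. (\<Sum>j\<le>N. lds_tail s j * rho ^ j)\<^sup>2) \<le> (\<Sum>n\<le>2 * N + 1. loss n * rho ^ n)"
proof -
  have G: "rho * (\<Sum>j\<le>N. lds_tail s j * rho ^ j) \<le> (\<Sum>i\<le>N + 1. indec_lds_tail s i * rho ^ i)" for s
  proof -
    have "rho * (\<Sum>j\<le>N. lds_tail s j * rho ^ j) = (\<Sum>j\<le>N. lds_tail s j * rho ^ Suc j)"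
      by (simp add: sum_distrib_left mult_ac)
    also have "\<dots> \<le> (\<Sum>j\<le>N. indec_lds_tail s (Suc j) * rho ^ Suc j)"
      using rho_pos by (intro sum_mono mult_right_mono lds_tail_le_indec) auto
    also have "\<dots> = (\<Sum>i\<le>N + 1. indec_lds_tail s i * rho ^ i)"
      unfolding Suc_eq_plus1[symmetric] sum.atMost_Suc_shift by (simp add: lds_tail_0)
    finally show ?thesis .
  qed
  have "rho * (\<Sum>j\<le>N. lds_tail s j * rho ^ j)\<^sup>2
      \<le> (\<Sum>n\<le>2 * N + 1. \<Sum>i\<le>n. (indec_lds_tail s i * rho ^ i) * (lds_tail s (n - i) * rho ^ (n - i)))" for s
  proof -
    have pos: "0 \<le> indec_lds_tail s i * rho ^ i" "0 \<le> lds_tail s i * rho ^ i" for i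
      using lds_tail_nonneg rho_pos by simp_all
    have "rho * (\<Sum>j\<le>N. lds_tail s j * rho ^ j)\<^sup>2
        \<le> (\<Sum>i\<le>N + 1. indec_lds_tail s i * rho ^ i) * (\<Sum>j\<le>N. lds_tail s j * rho ^ j)"
      using mult_right_mono[OF G[of s], of "\<Sum>j\<le>N. lds_tail s j * rho ^ j"] pos
      by (simp add: sum_nonneg power2_eq_square mult.assoc)
    also have "\<dots> \<le> (\<Sum>n\<le>(N + 1) + N. \<Sum>i\<le>n. (indec_lds_tail s i * rho ^ i) * (lds_tail s (n - i) * rho ^ (n - i)))"
      by (rule sum_cauchy_ge[OF pos])
    finally show ?thesis by (simp add: mult_2)
  qed
  then have "(\<Sum>s<M. rho * (\<Sum>j\<le>N. lds_tail s j * rho ^ j)\<^sup>2)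
      \<le> (\<Sum>s<M. \<Sum>n\<le>2 * N + 1. \<Sum>i\<le>n. (indec_lds_tail s i * rho ^ i) * (lds_tail s (n - i) * rho ^ (n - i)))"
    by (intro sum_mono)
  also have "\<dots> = (\<Sum>n\<le>2 * N + 1. \<Sum>s<M. \<Sum>i\<le>n. (indec_lds_tail s i * rho ^ i) * (lds_tail s (n - i) * rho ^ (n - i)))"
    by (rule sum.swap)
  also have "\<dots> = (\<Sum>n\<le>2 * N + 1. (\<Sum>s<M. \<Sum>i\<le>n. indec_lds_tail s i * lds_tail s (n - i)) * rho ^ n)"
  proof (rule sum.cong[OF refl])
    fix n
    have "(\<Sum>i\<le>n. (indec_lds_tail s i * rho ^ i) * (lds_tail s (n - i) * rho ^ (n - i)))
        = (\<Sum>i\<le>n. indec_lds_tail s i * lds_tail s (n - i)) * rho ^ n" for s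
      using fps_mult_nth_scaled[of "Abs_fps (indec_lds_tail s)" "Abs_fps (lds_tail s)" n rho]
      by (simp add: fps_mult_nth atMost_atLeast0)
    then show "(\<Sum>s<M. \<Sum>i\<le>n. (indec_lds_tail s i * rho ^ i) * (lds_tail s (n - i) * rho ^ (n - i)))
        = (\<Sum>s<M. \<Sum>i\<le>n. indec_lds_tail s i * lds_tail s (n - i)) * rho ^ n"
      by (simp add: sum_distrib_right)
  qed
  also have "\<dots> \<le> (\<Sum>n\<le>2 * N + 1. loss n * rho ^ n)"
    using rho_pos by (intro sum_mono mult_right_mono lds_tail_loss) auto
  finally show ?thesis by (simp add: sum_distrib_left)
qed

section \<open>Vanishing mean\<close>

abbreviation total_size :: "nat \<Rightarrow> real" where
  "total_size n \<equiv> real n * real (card (separable_perms n))"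

lemma size_fps_nth: "fps_nth (fps_X * fps_deriv sep_fps) n = total_size n"
  by (cases n) (simp_all add: sep_fps_def)

lemma total_size_Suc:
  "2 * total_size (Suc n) = 3 * dl n - (if n = 0 then 1 else dl (n - 1))"
proof -
  have "fps_const 2 * (fps_X * fps_deriv sep_fps)
      = fps_const 3 * (fps_X * delannoy_fps) - fps_X * (fps_X * delannoy_fps) - fps_X"
    using size_fps_eq by (simp only: numeral_fps_const)
  from arg_cong[OF this, of "\<lambda>F. fps_nth F (Suc n)"] show ?thesis
    unfolding size_fps_nth[symmetric] by (cases n) simp_all
qed

lemma total_size_le: "2 * total_size (Suc n) \<le> (3 - rho) * dl n"
proof (cases n)
  case 0
  then show ?thesis using total_size_Suc[of 0] rho_less_1 by (simp add: dl_0)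
next
  case (Suc m)
  then show ?thesis using total_size_Suc[of n] dl_bounds[of m] by (simp add: algebra_simps)
qed

lemma total_size_minus_lis: "total_size n - fps_nth lis_fps n = (\<Sum>i\<le>n. dl i * loss (n - i))"
proof -
  have "total_size n - fps_nth lis_fps n = fps_nth (fps_X * fps_deriv sep_fps - lis_fps) n"
    by (simp only: fps_sub_nth size_fps_nth)
  also have "\<dots> = fps_nth (delannoy_fps * loss_fps) n" by (simp only: size_minus_lis_fps)
  finally show ?thesis by (simp only: fps_mult_nth atMost_atLeast0)
qed

lemma total_size_pos: "0 < total_size (Suc n)"
  using separable_perms_nonempty finite_separable_perms by (simp add: card_gt_0_iff)

text \<open>By \<open>total_size_le\<close>, \<open>kappa\<close> bounds the ratio of
  \<open>total_size (Suc n) * rho ^ Suc n\<close> to \<open>dl n * rho ^ n\<close>.\<close>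

definition kappa :: real where "kappa = rho * (3 - rho) / 2"

lemma kappa_pos: "0 < kappa"
  using rho_pos rho_less_1 by (simp add: kappa_def)

text \<open>In the convolution for size minus LIS, \<open>dl_mono_rho\<close> bounds each Delannoy
  factor below by a power of \<open>rho\<close> times \<open>dl n\<close>, and
  \<open>total_size_le\<close> compares \<open>dl n\<close> with the total size.\<close>

lemma lis_upper:
  "fps_nth lis_fps (Suc n) / total_size (Suc n) \<le> 1 - (\<Sum>k\<le>Suc n. loss k * rho ^ k) / kappa"
proof -
  define L where "L = (\<Sum>k\<le>Suc n. loss k * rho ^ k)"
  define t where "t = total_size (Suc n)"
  define a where "a = fps_nth lis_fps (Suc n)"
  have "dl n * L = (\<Sum>k\<le>Suc n. dl n * (loss k * rho ^ k))" unfolding L_def by (rule sum_distrib_left)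
  also have "\<dots> \<le> (\<Sum>k\<le>Suc n. rho * (dl (Suc n - k) * loss k))"
  proof (rule sum_mono)
    fix k assume k: "k \<in> {..Suc n}"
    show "dl n * (loss k * rho ^ k) \<le> rho * (dl (Suc n - k) * loss k)"
    proof (cases k)
      \<comment> \<open>For \<open>k = 0\<close> the comparison of \<open>dl n\<close> with
        \<open>rho * dl (Suc n)\<close> goes the wrong way; the vanishing of \<open>loss 0\<close>
        saves it.\<close>
      case 0 then show ?thesis by (simp add: loss_0)
    next
      case (Suc j)
      have "rho ^ j * dl n \<le> dl (n - j)" using dl_mono_rho[of j "n - j"] k Suc by simp
      then have "rho * loss k * (rho ^ j * dl n) \<le> rho * loss k * dl (n - j)"
        using rho_pos loss_nonneg[of k] by (intro mult_left_mono) auto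
      then show ?thesis using Suc by (simp add: mult_ac)
    qed
  qed
  also have "\<dots> = rho * (\<Sum>k\<le>Suc n. dl (Suc n - k) * loss k)" by (rule sum_distrib_left[symmetric])
  also have "(\<Sum>k\<le>Suc n. dl (Suc n - k) * loss k) = (\<Sum>k\<le>Suc n. dl k * loss (Suc n - k))"
    by (rule sum.reindex_bij_witness[of _ "\<lambda>k. Suc n - k" "\<lambda>k. Suc n - k"]) auto
  also have "\<dots> = t - a" unfolding t_def a_def by (rule total_size_minus_lis[symmetric])
  finally have 1: "dl n * L \<le> rho * (t - a)" .
  have "0 \<le> L" unfolding L_def using loss_nonneg rho_pos by (intro sum_nonneg) simp
  then have "2 * t * L \<le> (3 - rho) * dl n * L"
    unfolding t_def by (rule mult_right_mono[OF total_size_le])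
  also have "\<dots> \<le> (3 - rho) * (rho * (t - a))"
    using mult_left_mono[OF 1, of "3 - rho"] rho_less_1 by (simp add: mult_ac)
  also have "\<dots> = 2 * (kappa * (t - a))" by (simp add: kappa_def)
  finally have "t * L \<le> kappa * (t - a)" by simp
  moreover have "0 < t" unfolding t_def by (rule total_size_pos)
  ultimately have "a / t \<le> 1 - L / kappa" using kappa_pos by (simp add: field_simps)
  then show ?thesis by (simp only: a_def t_def L_def)
qed

lemma lis_nonneg: "0 \<le> fps_nth lis_fps n"
  unfolding lis_fps_nth by (rule sum_nonneg) simp

text \<open>Otherwise the upper bound on the mean in \<open>lis_upper\<close> would be
  negative.\<close>

lemma loss_partial_le: "(\<Sum>k\<le>n. loss k * rho ^ k) \<le> kappa"
proof (cases n)
  case 0 then show ?thesis using kappa_pos by (simp add: loss_0)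
next
  case (Suc m)
  have "0 \<le> fps_nth lis_fps (Suc m) / total_size (Suc m)"
    by (intro divide_nonneg_nonneg lis_nonneg less_imp_le[OF total_size_pos])
  then have "(\<Sum>k\<le>Suc m. loss k * rho ^ k) / kappa \<le> 1" using lis_upper[of m] by linarith
  then show ?thesis using kappa_pos Suc by (simp add: field_simps)
qed

lemma loss_summable: "summable (\<lambda>k. loss k * rho ^ k)"
proof (rule bounded_imp_summable)
  show "0 \<le> loss n * rho ^ n" for n using loss_nonneg rho_pos by simp
  show "(\<Sum>k\<le>n. loss k * rho ^ k) \<le> kappa" for n by (rule loss_partial_le)
qed

definition loss_total :: real where "loss_total = (\<Sum>k. loss k * rho ^ k)"

lemma loss_partial_le_total: "(\<Sum>k\<le>n. loss k * rho ^ k) \<le> loss_total"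
  unfolding loss_total_def using loss_nonneg rho_pos by (intro sum_le_suminf loss_summable) auto

lemma loss_total_nonneg: "0 \<le> loss_total"
  using loss_partial_le_total[of 0] by (simp add: loss_0)

lemma sum_total_size:
  "2 * (\<Sum>n\<le>N. total_size (Suc n) * rho ^ Suc n)
     = 3 * rho * (\<Sum>j\<le>N. dl j * rho ^ j) - rho\<^sup>2 * (\<Sum>j<N. dl j * rho ^ j) - rho"
proof (induction N)
  case 0
  then show ?case using total_size_Suc[of 0] by (simp add: dl_0 algebra_simps)
next
  case (Suc N)
  have "2 * total_size (Suc (Suc N)) * rho ^ Suc (Suc N) = (3 * dl (Suc N) - dl N) * rho ^ Suc (Suc N)"
    using total_size_Suc[of "Suc N"] by simp
  then show ?case using Suc.IH by (simp add: algebra_simps power2_eq_square)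
qed

text \<open>LIS is size minus the convolution of \<open>dl\<close> and \<open>loss\<close>. With
  \<open>S\<close> the sum of Delannoy terms up to \<open>N\<close>, the sizes contribute at least
  \<open>kappa * S - rho / 2\<close> and the convolution at most
  \<open>(S + 1) * loss_total\<close>, the additional 1 bounding the term of index
  \<open>Suc N\<close>.\<close>

lemma sum_lis_lower:
  "(kappa - loss_total) * (\<Sum>j\<le>N. dl j * rho ^ j) - (rho / 2 + loss_total)
     \<le> (\<Sum>n\<le>Suc N. fps_nth lis_fps n * rho ^ n)"
proof -
  let ?s = "\<lambda>N. \<Sum>j\<le>N. dl j * rho ^ j"
  have pos: "0 \<le> dl i * rho ^ i" "0 \<le> loss i * rho ^ i" for i
    using dl_pos[of i] loss_nonneg rho_pos by simp_all
  have "(\<Sum>j<N. dl j * rho ^ j) \<le> ?s N" using pos by (intro sum_mono2) auto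
  then have "rho\<^sup>2 * (\<Sum>j<N. dl j * rho ^ j) \<le> rho\<^sup>2 * ?s N" by (intro mult_left_mono) auto
  moreover have "(\<Sum>n\<le>Suc N. total_size n * rho ^ n) = (\<Sum>n\<le>N. total_size (Suc n) * rho ^ Suc n)"
    unfolding sum.atMost_Suc_shift by simp
  ultimately have 1: "kappa * ?s N - rho / 2 \<le> (\<Sum>n\<le>Suc N. total_size n * rho ^ n)"
    using sum_total_size[of N] by (simp add: kappa_def algebra_simps power2_eq_square)
  have "(\<Sum>n\<le>Suc N. (total_size n - fps_nth lis_fps n) * rho ^ n)
      = (\<Sum>n\<le>Suc N. \<Sum>i\<le>n. (dl i * rho ^ i) * (loss (n - i) * rho ^ (n - i)))"
  proof (rule sum.cong[OF refl])
    fix n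
    have "(total_size n - fps_nth lis_fps n) * rho ^ n = fps_nth (delannoy_fps * loss_fps) n * rho ^ n"
      by (simp only: total_size_minus_lis fps_mult_nth atMost_atLeast0)
    then show "(total_size n - fps_nth lis_fps n) * rho ^ n = (\<Sum>i\<le>n. (dl i * rho ^ i) * (loss (n - i) * rho ^ (n - i)))"
      by (simp only: fps_mult_nth_scaled)
  qed
  also have "\<dots> \<le> ?s (Suc N) * (\<Sum>k\<le>Suc N. loss k * rho ^ k)" by (rule sum_cauchy_le[OF pos])
  also have "\<dots> \<le> ?s (Suc N) * loss_total"
    using pos by (intro mult_left_mono loss_partial_le_total sum_nonneg) auto
  also have "\<dots> \<le> (?s N + 1) * loss_total"
    using dl_mono_rho[of "Suc N" 0] loss_total_nonneg by (intro mult_right_mono) (simp_all add: dl_0 mult_ac)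
  finally have "(\<Sum>n\<le>Suc N. (total_size n - fps_nth lis_fps n) * rho ^ n) \<le> (?s N + 1) * loss_total" .
  then show ?thesis using 1 by (simp only: left_diff_distrib sum_subtractf) (simp add: algebra_simps)
qed

section \<open>Partial sums of LIS at \<open>rho\<close> from square-summable tails\<close>

lemma summable_squares_sum_small:
  fixes F :: "nat \<Rightarrow> real"
  assumes "summable (\<lambda>s. (F s)\<^sup>2)" "0 < e"
  shows "eventually (\<lambda>N. (\<Sum>s<N. F s) \<le> e * sqrt (real N)) sequentially"
proof -
  have "0 < (e / 2)\<^sup>2" using assms(2) by simp
  with assms(1) obtain M where M: "\<And>m n. M \<le> m \<Longrightarrow> norm (\<Sum>s=m..<n. (F s)\<^sup>2) < (e / 2)\<^sup>2"
    unfolding summable_Cauchy by blast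
  \<comment> \<open>The head up to \<open>M\<close> is a constant and is absorbed by
    \<open>sqrt N\<close>; beyond \<open>M\<close>, Cauchy-Schwarz applies with a sum of squares
    below \<open>(e / 2)^2\<close>.\<close>
  define C where "C = (\<Sum>s<M. F s)"
  have "eventually (\<lambda>N. C \<le> e / 2 * sqrt (real N)) sequentially"
    using assms(2) by real_asymp
  moreover have "eventually (\<lambda>N. M \<le> N) sequentially" by (rule eventually_ge_at_top)
  ultimately show ?thesis
  proof eventually_elim
    case (elim N)
    have "(\<Sum>s\<in>{M..<N}. F s)\<^sup>2 \<le> (\<Sum>s\<in>{M..<N}. (F s)\<^sup>2) * (\<Sum>s\<in>{M..<N}. 1\<^sup>2)"
      using Cauchy_Schwarz_ineq_sum[of F "\<lambda>_. 1" "{M..<N}"] by simp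
    also have "\<dots> \<le> (e / 2)\<^sup>2 * real N"
      using M[of M N] by (intro mult_mono) (auto intro: sum_nonneg)
    also have "\<dots> = (e / 2 * sqrt (real N))\<^sup>2" by (simp add: power_mult_distrib power_divide)
    finally have "(\<Sum>s\<in>{M..<N}. F s) \<le> e / 2 * sqrt (real N)"
      by (rule power2_le_imp_le) (use assms(2) in simp)
    moreover have "(\<Sum>s<N. F s) = C + (\<Sum>s\<in>{M..<N}. F s)"
      using elim(2) unfolding C_def by (metis lessThan_atLeast0 sum.atLeastLessThan_concat zero_le)
    ultimately show ?case using elim(1) by (simp add: field_simps)
  qed
qed

text \<open>The squared tail weights truncated at size \<open>N\<close> have sums bounded uniformly
  in \<open>M\<close> and \<open>N\<close>. Letting first \<open>N\<close> and then \<open>M\<close>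
  grow gives square summability of the full weights \<open>F\<close>.\<close>

lemma sum_lis_upper:
  assumes "0 < e"
  shows "eventually (\<lambda>N. (\<Sum>n\<le>N. fps_nth lis_fps n * rho ^ n) \<le> e * sqrt (real N)) sequentially"
proof -
  define G where "G = (\<lambda>N s. \<Sum>j\<le>N. lds_tail s j * rho ^ j)"
  have pos: "0 \<le> lds_tail s j * rho ^ j" for s j using lds_tail_nonneg rho_pos by simp
  have Gpos: "0 \<le> G N s" for N s unfolding G_def by (intro sum_nonneg pos)
  have bound: "(\<Sum>s<M. (G N s)\<^sup>2) \<le> loss_total / rho" for M N
  proof -
    have "rho * (\<Sum>s<M. (G N s)\<^sup>2) \<le> loss_total"
      unfolding G_def by (rule order_trans[OF sum_lds_tail_square loss_partial_le_total])
    then show ?thesis using rho_pos by (simp add: pos_le_divide_eq mult.commute)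
  qed
  have "summable (\<lambda>j. lds_tail s j * rho ^ j)" for s
  proof (rule bounded_imp_summable[OF pos])
    fix N
    \<comment> \<open>A single square is at most the whole sum; the upper limit \<open>Suc s\<close>
      refers to the fixed \<open>s\<close>, not to the summation variable.\<close>
    have "(G N s)\<^sup>2 \<le> (\<Sum>s<Suc s. (G N s)\<^sup>2)" by (simp add: sum_nonneg)
    also have "\<dots> \<le> loss_total / rho" by (rule bound)
    finally show "(\<Sum>j\<le>N. lds_tail s j * rho ^ j) \<le> sqrt (loss_total / rho)"
      by (intro real_le_rsqrt) (simp add: G_def)
  qed
  note summ = this
  define F where "F = (\<lambda>s. \<Sum>j. lds_tail s j * rho ^ j)"
  have lim: "(\<lambda>N. G N s) \<longlonglongrightarrow> F s" for s
    unfolding G_def F_def using summable_LIMSEQ'[OF summ] .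
  have le: "G N s \<le> F s" for N s
    unfolding G_def F_def by (intro sum_le_suminf summ) (auto intro: pos)
  have "summable (\<lambda>s. (F s)\<^sup>2)"
  proof (rule bounded_imp_summable)
    fix M
    have "(\<lambda>N. \<Sum>s\<le>M. (G N s)\<^sup>2) \<longlonglongrightarrow> (\<Sum>s\<le>M. (F s)\<^sup>2)"
      by (intro tendsto_intros lim)
    then show "(\<Sum>s\<le>M. (F s)\<^sup>2) \<le> loss_total / rho"
      by (rule LIMSEQ_le_const2)
         (intro exI allI impI, rule bound[where M = "Suc M", unfolded lessThan_Suc_atMost])
  qed simp
  from summable_squares_sum_small[OF this assms] show ?thesis
  proof eventually_elim
    case (elim N)
    \<comment> \<open>As LDS is at most the size, hence at most \<open>N\<close>, thresholds
      \<open>s < N\<close> suffice.\<close>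
    have "(\<Sum>n\<le>N. fps_nth lis_fps n * rho ^ n) = (\<Sum>n\<le>N. \<Sum>s<N. lds_tail s n * rho ^ n)"
      by (intro sum.cong refl) (simp add: lis_fps_nth_tail sum_distrib_right)
    also have "\<dots> = (\<Sum>s<N. G N s)" unfolding G_def by (rule sum.swap)
    also have "\<dots> \<le> (\<Sum>s<N. F s)" by (intro sum_mono le)
    finally show ?case using elim by linarith
  qed
qed

text \<open>With a positive gap \<open>c\<close>, \<open>sum_lis_lower\<close> and
  \<open>sum_dl_lower\<close> give at least \<open>c * sqrt (N + 1) - K\<close>, while
  \<open>sum_lis_upper\<close> allows only half of the leading term.\<close>

lemma loss_total_eq: "loss_total = kappa"
proof (rule ccontr)
  assume "loss_total \<noteq> kappa"
  moreover have "loss_total \<le> kappa"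
    unfolding loss_total_def
  proof (intro suminf_le_const loss_summable)
    fix n
    have "(\<Sum>k<n. loss k * rho ^ k) \<le> (\<Sum>k\<le>n. loss k * rho ^ k)"
      using loss_nonneg rho_pos by (intro sum_mono2) auto
    then show "(\<Sum>k<n. loss k * rho ^ k) \<le> kappa" using loss_partial_le[of n] by linarith
  qed
  ultimately have c: "0 < kappa - loss_total" by simp
  define c where "c = kappa - loss_total"
  define K where "K = rho / 2 + loss_total"
  have "eventually (\<lambda>N. (\<Sum>n\<le>Suc N. fps_nth lis_fps n * rho ^ n) \<le> c / 2 * sqrt (real (Suc N))) sequentially"
    using sum_lis_upper[of "c / 2"] c by (subst eventually_sequentially_Suc) (simp add: c_def)
  moreover have "eventually (\<lambda>N. K < c / 2 * sqrt (real (Suc N))) sequentially"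
    using c unfolding c_def[symmetric] by real_asymp
  ultimately have "eventually (\<lambda>N::nat. False) sequentially"
  proof eventually_elim
    case (elim N)
    have "c * sqrt (real (Suc N)) - K \<le> (\<Sum>n\<le>Suc N. fps_nth lis_fps n * rho ^ n)"
      using sum_lis_lower[of N] mult_left_mono[OF sum_dl_lower[of N], of c] c
      unfolding c_def K_def by linarith
    then show False using elim by (simp add: field_simps)
  qed
  then show False by simp
qed

lemma mean_lis_tendsto_0: "(\<lambda>n. fps_nth lis_fps n / total_size n) \<longlonglongrightarrow> 0"
proof (rule LIMSEQ_imp_Suc, rule tendsto_sandwich)
  show "eventually (\<lambda>n. 0 \<le> fps_nth lis_fps (Suc n) / total_size (Suc n)) sequentially"
    by (intro always_eventually allI divide_nonneg_nonneg lis_nonneg less_imp_le[OF total_size_pos])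
  show "eventually (\<lambda>n. fps_nth lis_fps (Suc n) / total_size (Suc n)
      \<le> 1 - (\<Sum>k\<le>Suc n. loss k * rho ^ k) / kappa) sequentially"
    by (intro always_eventually allI lis_upper)
  have "(\<lambda>n. \<Sum>k\<le>n. loss k * rho ^ k) \<longlonglongrightarrow> kappa"
    using summable_LIMSEQ'[OF loss_summable] loss_total_eq by (simp add: loss_total_def)
  then have "(\<lambda>n. \<Sum>k\<le>Suc n. loss k * rho ^ k) \<longlonglongrightarrow> kappa" by (rule LIMSEQ_Suc)
  then have "(\<lambda>n. 1 - (\<Sum>k\<le>Suc n. loss k * rho ^ k) / kappa) \<longlonglongrightarrow> 1 - kappa / kappa"
    using kappa_pos by (intro tendsto_intros) auto
  also have "1 - kappa / kappa = 0" using kappa_pos by simp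
  finally show "(\<lambda>n. 1 - (\<Sum>k\<le>Suc n. loss k * rho ^ k) / kappa) \<longlonglongrightarrow> 0" .
qed simp

text \<open>Markov's inequality for the uniform distribution.\<close>

lemma prob_lis_le:
  assumes "0 < e"
  shows "measure (measure_pmf (pmf_of_set (separable_perms n))) {\<sigma>. \<bar>real (LIS n \<sigma>) / real n - 0\<bar> > e}
     \<le> fps_nth lis_fps n / total_size n / e"
proof (cases "n = 0")
  case True
  \<comment> \<open>Division by zero yields 0, so the event is empty and the right-hand side
    vanishes.\<close>
  then show ?thesis using assms by simp
next
  case False
  let ?S = "separable_perms n" and ?X = "{\<sigma>. \<bar>real (LIS n \<sigma>) / real n - 0\<bar> > e}"
  have pos: "0 < real (card ?S)" using separable_perms_nonempty finite_separable_perms by (simp add: card_gt_0_iff)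
  have "real (card (?S \<inter> ?X)) * (e * real n) = (\<Sum>\<sigma>\<in>?S \<inter> ?X. e * real n)" by simp
  also have "\<dots> \<le> (\<Sum>\<sigma>\<in>?S \<inter> ?X. real (LIS n \<sigma>))"
    using False by (intro sum_mono) (auto simp: field_simps)
  also have "\<dots> \<le> (\<Sum>\<sigma>\<in>?S. real (LIS n \<sigma>))"
    by (intro sum_mono2 finite_separable_perms) auto
  finally have "real (card (?S \<inter> ?X)) * (e * real n) \<le> fps_nth lis_fps n" by (simp add: lis_fps_nth)
  then have "real (card (?S \<inter> ?X)) / real (card ?S) \<le> fps_nth lis_fps n / total_size n / e"
    using pos False assms by (simp add: field_simps)
  then show ?thesis
    by (simp add: measure_pmf_of_set separable_perms_nonempty finite_separable_perms)
qed

theorem theorem1p7: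
  shows "converges_in_prob_const
           (\<lambda>n. measure_pmf (pmf_of_set (separable_perms n)))
           (\<lambda>n \<sigma>. real (LIS n \<sigma>) / real n) 0"
  unfolding converges_in_prob_const_def
proof (intro conjI allI impI)
  fix e :: real assume e: "0 < e"
  show "(\<lambda>n. measure (measure_pmf (pmf_of_set (separable_perms n)))
      {\<sigma> \<in> space (measure_pmf (pmf_of_set (separable_perms n))). \<bar>real (LIS n \<sigma>) / real n - 0\<bar> > e}) \<longlonglongrightarrow> 0"
  proof (rule Lim_null_comparison)
    show "(\<lambda>n. fps_nth lis_fps n / total_size n / e) \<longlonglongrightarrow> 0"
      using tendsto_divide[OF mean_lis_tendsto_0 tendsto_const, of e] e by simp
    show "eventually (\<lambda>n. norm (measure (measure_pmf (pmf_of_set (separable_perms n)))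
      {\<sigma> \<in> space (measure_pmf (pmf_of_set (separable_perms n))). \<bar>real (LIS n \<sigma>) / real n - 0\<bar> > e})
      \<le> fps_nth lis_fps n / total_size n / e) sequentially"
      using prob_lis_le[OF e] by (intro always_eventually allI) simp
  qed
qed (simp_all add: measure_pmf.prob_space_axioms)

end
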